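(* Let $(\Omega,\mathcal F,\mathbb P)$ be a complete measure space and let $\mathcal H$ be a real Hilbert space. For $v\in L^2(\Omega,\mathcal H)$ let $H_v:\mathcal H\to L^2(\Omega)$ be the operator $(H_vx)(\omega)=\langle v(\omega),x\rangle_{\mathcal H}$. Then the correspondence $v\mapsto H_v$ is an isometric isomorphism between $L^2(\Omega,\mathcal H)$ and $\mathrm{HS}(\mathcal H,L^2(\Omega))$.
   Context: A function $v:\Omega\to\mathcal H$ is simple if $\mathbb P$-a.e. $v(\omega)=\sum_{n=1}^N \mathbb I_{E_n}(\omega)e_n$ with $E_n\in\mathcal F$, $e_n\in\mathcal H$; it is Bochner measurable if there are simple functions $v_n$ with $\|v_n(\omega)-v(\omega)\|_{\mathcal H}\to 0$ for $\mathbb P$-a.e. $\omega$. $L^2(\Omega,\mathcal H)$ is the Hilbert space of ($\mathbb P$-a.e. equivalence classes of) Bochner measurable $v:\Omega\to\mathcal H$ with $\int_\Omega\|v(\omega)\|_{\mathcal H}^2\,d\mathbb P<\infty$, with inner product $\langle u,v\rangle_{L^2(\Omega,\mathcal H)}=\int_\Omega\langle u(\omega),v(\omega)\rangle_{\mathcal H}\,d\mathbb P$. $L^2(\Omega)$ is the space of (classes of) real-valued square-integrable $\mathcal F$-measurable functions. For real Hilbert spaces $\mathcal H,\mathcal G$ (not necessarily separable), $\mathrm{HS}(\mathcal H,\mathcal G)$ is the space of Hilbert-Schmidt operators: bounded linear $H:\mathcal H\to\mathcal G$ with $\sum_{e\in\mathscr E}\|He\|_{\mathcal G}^2<\infty$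 for an arbitrary orthonormal basis $\mathscr E$ of $\mathcal H$. It carries the norm $\|H\|_{\mathrm{HS}(\mathcal H,\mathcal G)}=\left(\sum_{e\in\mathscr E}\|He\|_{\mathcal G}^2\right)^{1/2}$ (independent of $\mathscr E$). *)

theory Defs
  imports "HOL-Analysis.Analysis"
begin

section \<open>Normed spaces with an explicit carrier\<close>

text \<open>A type cannot depend on the measure, so \<open>L\<^sup>2\<close> and the Hilbert--Schmidt operators into it are
  given as carriers with operations. Abstract Hilbert spaces are types of class
  \<^class>\<open>real_inner\<close> and \<^class>\<open>complete_space\<close>.\<close>

record 'v normed_structure =
  vcarrier :: "'v set"
  vadd :: "'v \<Rightarrow> 'v \<Rightarrow> 'v"
  vscale :: "real \<Rightarrow> 'v \<Rightarrow> 'v"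
  vnorm :: "'v \<Rightarrow> real"

definition isometric_isomorphism ::
  "'u normed_structure \<Rightarrow> 'v normed_structure \<Rightarrow> ('u \<Rightarrow> 'v) \<Rightarrow> bool" where
  "isometric_isomorphism U V \<phi> \<longleftrightarrow>
     bij_betw \<phi> (vcarrier U) (vcarrier V) \<and>
     (\<forall>x\<in>vcarrier U. \<forall>y\<in>vcarrier U. \<phi> (vadd U x y) = vadd V (\<phi> x) (\<phi> y)) \<and>
     (\<forall>c. \<forall>x\<in>vcarrier U. \<phi> (vscale U c x) = vscale V c (\<phi> x)) \<and>
     (\<forall>x\<in>vcarrier U. vnorm V (\<phi> x) = vnorm U x)"

section \<open>Bochner measurability\<close>

text \<open>The library's \<^const>\<open>borel_measurable\<close> would be too weak for a non-separable
  range, hence the explicit approximation by simple functions.\<close>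

definition ae_simple :: "'a measure \<Rightarrow> ('a \<Rightarrow> 'h::real_normed_vector) \<Rightarrow> bool" where
  "ae_simple M v \<longleftrightarrow>
     (\<exists>(N::nat) (E :: nat \<Rightarrow> 'a set) (e :: nat \<Rightarrow> 'h).
        (\<forall>n\<in>{1..N}. E n \<in> sets M) \<and>
        (AE \<omega> in M. v \<omega> = (\<Sum>n=1..N. indicator (E n) \<omega> *\<^sub>R e n)))"

definition bochner_measurable :: "'a measure \<Rightarrow> ('a \<Rightarrow> 'h::real_normed_vector) \<Rightarrow> bool" where
  "bochner_measurable M v \<longleftrightarrow>
     (\<exists>s :: nat \<Rightarrow> 'a \<Rightarrow> 'h. (\<forall>n. ae_simple M (s n)) \<and>
        (AE \<omega> in M. (\<lambda>n. norm (s n \<omega> - v \<omega>)) \<longlonglongrightarrow> 0))"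

section \<open>Spaces of almost-everywhere equivalence classes\<close>

definition ae_rel :: "'a measure \<Rightarrow> ('a \<Rightarrow> 'b) set \<Rightarrow> (('a \<Rightarrow> 'b) \<times> ('a \<Rightarrow> 'b)) set" where
  "ae_rel M S = {(f, g). f \<in> S \<and> g \<in> S \<and> (AE \<omega> in M. f \<omega> = g \<omega>)}"

lemma equiv_ae_rel: "equiv S (ae_rel M S)"
  by (rule equivI) (auto simp: ae_rel_def refl_on_def sym_def trans_def)

definition ae_class :: "'a measure \<Rightarrow> ('a \<Rightarrow> 'b) set \<Rightarrow> ('a \<Rightarrow> 'b) \<Rightarrow> ('a \<Rightarrow> 'b) set" where
  "ae_class M S f = ae_rel M S `` {f}"

text \<open>Two representatives of a class agree almost everywhere, so none of the operations below
  depends on the choice made here.\<close>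

definition rep :: "('a \<Rightarrow> 'b) set \<Rightarrow> 'a \<Rightarrow> 'b" where
  "rep A = (SOME f. f \<in> A)"

definition l2_inner :: "'a measure \<Rightarrow> ('a \<Rightarrow> 'h::real_inner) set \<Rightarrow> ('a \<Rightarrow> 'h) set \<Rightarrow> real" where
  "l2_inner M A B = (\<integral>\<omega>. rep A \<omega> \<bullet> rep B \<omega> \<partial>M)"

definition l2_structure ::
  "'a measure \<Rightarrow> ('a \<Rightarrow> 'h::real_inner) set \<Rightarrow> ('a \<Rightarrow> 'h) set normed_structure" where
  "l2_structure M S = \<lparr>
     vcarrier = S // ae_rel M S,
     vadd = (\<lambda>A B. ae_class M S (\<lambda>\<omega>. rep A \<omega> + rep B \<omega>)),
     vscale = (\<lambda>c A. ae_class M S (\<lambda>\<omega>. c *\<^sub>R rep A \<omega>)),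
     vnorm = (\<lambda>A. sqrt (l2_inner M A A)) \<rparr>"

definition bochner_square_integrable :: "'a measure \<Rightarrow> ('a \<Rightarrow> 'h::real_inner) set" where
  "bochner_square_integrable M =
     {v. bochner_measurable M v \<and> integrable M (\<lambda>\<omega>. (norm (v \<omega>))\<^sup>2)}"

definition real_square_integrable :: "'a measure \<Rightarrow> ('a \<Rightarrow> real) set" where
  "real_square_integrable M =
     {f. f \<in> borel_measurable M \<and> integrable M (\<lambda>\<omega>. (f \<omega>)\<^sup>2)}"

definition L2_bochner :: "'a measure \<Rightarrow> ('a \<Rightarrow> 'h::real_inner) set normed_structure" where
  "L2_bochner M = l2_structure M (bochner_square_integrable M)"

definition L2_real :: "'a measure \<Rightarrow> ('a \<Rightarrow> real) set normed_structure" where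
  "L2_real M = l2_structure M (real_square_integrable M)"

section \<open>Hilbert--Schmidt operators\<close>

definition orthonormal_basis :: "'h::real_inner set \<Rightarrow> bool" where
  "orthonormal_basis E \<longleftrightarrow>
     pairwise orthogonal E \<and> (\<forall>e\<in>E. norm e = 1) \<and> closure (span E) = UNIV"

definition bounded_linear_into ::
  "'g normed_structure \<Rightarrow> ('h::real_normed_vector \<Rightarrow> 'g) \<Rightarrow> bool" where
  "bounded_linear_into G T \<longleftrightarrow>
     (\<forall>x. T x \<in> vcarrier G) \<and>
     (\<forall>x y. T (x + y) = vadd G (T x) (T y)) \<and>
     (\<forall>c x. T (c *\<^sub>R x) = vscale G c (T x)) \<and>
     (\<exists>K. \<forall>x. vnorm G (T x) \<le> K * norm x)"

definition hs_operators ::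
  "'g normed_structure \<Rightarrow> ('h::{real_inner,complete_space} \<Rightarrow> 'g) set" where
  "hs_operators G = {T. bounded_linear_into G T \<and>
     (\<forall>E. orthonormal_basis E \<longrightarrow> (\<lambda>e. (vnorm G (T e))\<^sup>2) summable_on E)}"

text \<open>The norm is the common value over all orthonormal bases.\<close>

definition hs_norm ::
  "'g normed_structure \<Rightarrow> ('h::{real_inner,complete_space} \<Rightarrow> 'g) \<Rightarrow> real" where
  "hs_norm G T = (THE c. \<forall>E. orthonormal_basis E \<longrightarrow>
     c = sqrt (\<Sum>\<^sub>\<infinity>e\<in>E. (vnorm G (T e))\<^sup>2))"

definition HS ::
  "'g normed_structure \<Rightarrow> ('h::{real_inner,complete_space} \<Rightarrow> 'g) normed_structure" where
  "HS G = \<lparr>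
     vcarrier = hs_operators G,
     vadd = (\<lambda>T U x. vadd G (T x) (U x)),
     vscale = (\<lambda>c T x. vscale G c (T x)),
     vnorm = hs_norm G \<rparr>"

definition H_op :: "'a measure \<Rightarrow> ('a \<Rightarrow> 'h::real_inner) set \<Rightarrow> 'h \<Rightarrow> ('a \<Rightarrow> real) set" where
  "H_op M v x = ae_class M (real_square_integrable M) (\<lambda>\<omega>. rep v \<omega> \<bullet> x)"

end

theory Submission
  imports Defs
begin

text \<open>
  Fix an orthonormal basis \<open>E\<close> of \<open>\<H>\<close>. Parseval's identity holds at each point \<open>\<omega>\<close>:
  \<open>\<parallel>v(\<omega>)\<parallel>\<^sup>2 = \<Sum>e\<in>E. \<langle>v(\<omega>), e\<rangle>\<^sup>2\<close>. Integrated over \<open>\<Omega>\<close>, it says that the sum of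
  \<open>\<parallel>H\<^sub>v e\<parallel>\<^sup>2\<close> over \<open>e \<in> E\<close> is \<open>\<parallel>v\<parallel>\<^sup>2\<close> (lemma \<open>integrated_Parseval\<close>). So \<open>H\<^sub>v\<close> is Hilbert--Schmidt and
  \<open>v \<mapsto> H\<^sub>v\<close> preserves norms; since the map is linear, it is injective. The basis may be uncountable,
  but sum and integral can still be exchanged: a Bochner measurable function takes almost all its
  values in the closure of a countable set, and each vector of that set is orthogonal to all but
  countably many basis vectors.

  Conversely, let \<open>T\<close> be Hilbert--Schmidt. Only countably many basis vectors \<open>b\<^sub>n\<close> have \<open>T b\<^sub>n \<noteq> 0\<close>.
  As \<open>\<Sum>n. \<parallel>T b\<^sub>n\<parallel>\<^sup>2\<close> is finite, \<open>\<Sum>n. (T b\<^sub>n)(\<omega>)\<^sup>2\<close> is finite for almost every \<open>\<omega>\<close>, so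
  \<open>v(\<omega>) = \<Sum>n. (T b\<^sub>n)(\<omega>) b\<^sub>n\<close> converges there by completeness of \<open>\<H>\<close>, and it is an element of
  \<open>L\<^sup>2(\<Omega>, \<H>)\<close> (lemma \<open>orthogonal_series_square_integrable\<close>). By construction \<open>H\<^sub>v\<close> and \<open>T\<close> agree on
  \<open>E\<close>; both are linear and bounded and the span of \<open>E\<close> is dense, so \<open>H\<^sub>v = T\<close> (lemma
  \<open>bounded_linear_into_L2_eqI\<close>).

  The Hilbert--Schmidt norm is defined as the common value over all orthonormal bases. It determines
  a number only because a basis exists in every Hilbert space, separable or not (lemma
  \<open>orthonormal_basis_exists\<close>).
\<close>

section \<open>Orthogonal series and orthonormal bases\<close>

text \<open>
  Partial sums form a Cauchy sequence by Pythagoras. The \<open>b n\<close> are only required to have norm at most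
  one, not exactly one: this allows zeros, so that a finite orthonormal set can also be written as a
  sequence.
\<close>

lemma orthogonal_series:
  fixes b :: "nat \<Rightarrow> 'h::{real_inner,complete_space}"
  assumes orth: "\<And>m n. m \<noteq> n \<Longrightarrow> b m \<bullet> b n = 0"
    and norm_le: "\<And>n. norm (b n) \<le> 1"
    and c: "summable (\<lambda>n. (c n)\<^sup>2)"
  shows summable_orthogonal_series: "summable (\<lambda>n. c n *\<^sub>R b n)"
    and inner_orthogonal_series: "(\<Sum>n. c n *\<^sub>R b n) \<bullet> b m = c m * (norm (b m))\<^sup>2"
    and norm_orthogonal_series:
      "(\<lambda>n. (c n)\<^sup>2 * (norm (b n))\<^sup>2) sums (norm (\<Sum>n. c n *\<^sub>R b n))\<^sup>2"
proof -
  have Pyth: "(norm (\<Sum>n\<in>I. c n *\<^sub>R b n))\<^sup>2 = (\<Sum>n\<in>I. (c n)\<^sup>2 * (norm (b n))\<^sup>2)"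
    if "finite I" for I
    by (subst norm_sum_Pythagorean[OF that])
      (auto simp: pairwise_def orthogonal_def orth power_mult_distrib)
  let ?P = "\<lambda>n. \<Sum>k<n. c k *\<^sub>R b k"
  have "Cauchy ?P"
    unfolding Cauchy_altdef2
  proof (intro allI impI)
    fix e :: real assume "0 < e"
    then obtain N where N: "\<And>m n. m \<ge> N \<Longrightarrow> norm (\<Sum>k=m..<n. (c k)\<^sup>2) < e\<^sup>2"
      using c unfolding summable_Cauchy by (metis zero_less_power)
    have "dist (?P n) (?P N) < e" if "n \<ge> N" for n
    proof -
      have "?P n - ?P N = (\<Sum>k=N..<n. c k *\<^sub>R b k)"
        using that by (simp add: sum_diff_nat_ivl lessThan_atLeast0)
      then have "(dist (?P n) (?P N))\<^sup>2 = (\<Sum>k=N..<n. (c k)\<^sup>2 * (norm (b k))\<^sup>2)"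
        by (simp add: dist_norm Pyth)
      also have "\<dots> \<le> (\<Sum>k=N..<n. (c k)\<^sup>2)"
        by (intro sum_mono mult_left_le) (auto simp: norm_le abs_square_le_1)
      also have "\<dots> < e\<^sup>2" using N[of N n] by simp
      finally show ?thesis using \<open>0 < e\<close> by (simp add: power_less_imp_less_base)
    qed
    then show "\<exists>N. \<forall>n\<ge>N. dist (?P n) (?P N) < e" by blast
  qed
  then show s: "summable (\<lambda>n. c n *\<^sub>R b n)"
    by (auto simp: summable_iff_convergent Cauchy_convergent_iff)
  then have P: "?P \<longlonglongrightarrow> (\<Sum>n. c n *\<^sub>R b n)"
    using summable_LIMSEQ by blast
  have "(\<lambda>n. (norm (?P n))\<^sup>2) \<longlonglongrightarrow> (norm (\<Sum>n. c n *\<^sub>R b n))\<^sup>2"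
    by (intro tendsto_intros P)
  then show "(\<lambda>n. (c n)\<^sup>2 * (norm (b n))\<^sup>2) sums (norm (\<Sum>n. c n *\<^sub>R b n))\<^sup>2"
    by (simp add: sums_def Pyth)
  have "(\<lambda>n. (c n *\<^sub>R b n) \<bullet> b m) sums ((\<Sum>n. c n *\<^sub>R b n) \<bullet> b m)"
    using bounded_linear.sums[OF bounded_linear_inner_left summable_sums[OF s]] .
  moreover have "(\<lambda>n. (c n *\<^sub>R b n) \<bullet> b m) = (\<lambda>n. if n = m then c m * (norm (b m))\<^sup>2 else 0)"
    by (auto simp: fun_eq_iff orth power2_norm_eq_inner)
  ultimately show "(\<Sum>n. c n *\<^sub>R b n) \<bullet> b m = c m * (norm (b m))\<^sup>2"
    using sums_single[of m "\<lambda>_. c m * (norm (b m))\<^sup>2"] sums_unique2 by fastforce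
qed

text \<open>
  Padding with zeros writes every countable set, finite or infinite, as a sequence, so that results on
  series apply to sums over it. The padding does not change sums of functions that vanish at zero.
\<close>

lemma enumerate_with_zeros:
  fixes C :: "'h::real_vector set"
  assumes "countable C" "0 \<notin> C"
  obtains b :: "nat \<Rightarrow> 'h" where "\<And>n. b n \<in> insert 0 C"
    and "\<And>m n. b m = b n \<Longrightarrow> b m \<noteq> 0 \<Longrightarrow> m = n"
    and "\<And>(g :: 'h \<Rightarrow> real) s. g 0 = 0 \<Longrightarrow> (g has_sum s) C \<longleftrightarrow> ((\<lambda>n. g (b n)) has_sum s) UNIV"
    and "C \<subseteq> range b"
proof -
  define I where "I = to_nat_on C ` C"
  define b where "b n = (if n \<in> I then from_nat_into C n else 0)" for n
  have b_to_nat: "b (to_nat_on C x) = x" if "x \<in> C" for x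
    using that assms by (auto simp: b_def I_def)
  have bij: "bij_betw b I C"
    by (rule bij_betw_byWitness[where f' = "to_nat_on C"])
      (auto simp: I_def b_to_nat)
  have bC: "b n \<in> insert 0 C" for n
    using bij by (cases "n \<in> I") (auto simp: b_def bij_betw_def)
  have I: "n \<in> I" if "b n \<noteq> 0" for n
    using that by (auto simp: b_def split: if_splits)
  show thesis
  proof
    show "m = n" if "b m = b n" "b m \<noteq> 0" for m n
      using that bij I[of m] I[of n] by (auto simp: bij_betw_def inj_on_def)
    show "(g has_sum s) C \<longleftrightarrow> ((\<lambda>n. g (b n)) has_sum s) UNIV" if "g 0 = 0" for g :: "'h \<Rightarrow> real" and s
    proof -
      have "(g has_sum s) C \<longleftrightarrow> ((\<lambda>n. g (b n)) has_sum s) I"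
        by (rule has_sum_reindex_bij_betw[OF bij, symmetric])
      also have "\<dots> \<longleftrightarrow> ((\<lambda>n. g (b n)) has_sum s) UNIV"
        by (rule has_sum_cong_neutral) (auto simp: b_def that)
      finally show ?thesis .
    qed
    show "C \<subseteq> range b" using b_to_nat by (metis rangeI subsetI)
  qed (rule bC)
qed

definition orthonormal :: "'h::real_inner set \<Rightarrow> bool" where
  "orthonormal E \<longleftrightarrow> pairwise orthogonal E \<and> (\<forall>e\<in>E. norm e = 1)"

lemma orthonormal_inner:
  "orthonormal E \<Longrightarrow> e \<in> E \<Longrightarrow> f \<in> E \<Longrightarrow> e \<bullet> f = (if e = f then 1 else 0)"
  by (auto simp: orthonormal_def pairwise_def orthogonal_def norm_eq_1)

lemma orthonormal_enumerate:
  fixes C :: "'h::real_inner set"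
  assumes "orthonormal C" "countable C"
  obtains b :: "nat \<Rightarrow> 'h" where "\<And>n. b n \<in> insert 0 C" "C \<subseteq> range b"
    and "\<And>m n. m \<noteq> n \<Longrightarrow> b m \<bullet> b n = 0" "\<And>n. norm (b n) \<le> 1"
    and "\<And>(g :: 'h \<Rightarrow> real) s. g 0 = 0 \<Longrightarrow> (g has_sum s) C \<longleftrightarrow> ((\<lambda>n. g (b n)) has_sum s) UNIV"
proof -
  have "0 \<notin> C" using assms by (auto simp: orthonormal_def)
  then obtain b :: "nat \<Rightarrow> 'h" where b: "\<And>n. b n \<in> insert 0 C"
    "\<And>m n. b m = b n \<Longrightarrow> b m \<noteq> 0 \<Longrightarrow> m = n"
    "\<And>(g :: 'h \<Rightarrow> real) s. g 0 = 0 \<Longrightarrow> (g has_sum s) C \<longleftrightarrow> ((\<lambda>n. g (b n)) has_sum s) UNIV"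
    "C \<subseteq> range b"
    using enumerate_with_zeros[OF assms(2)] by metis
  show thesis
  proof (rule that[OF b(1) b(4) _ _ b(3)])
    show "b m \<bullet> b n = 0" if "m \<noteq> n" for m n
    proof (cases "b m = 0 \<or> b n = 0")
      case False
      then have "b m \<in> C" "b n \<in> C" "b m \<noteq> b n"
        using b(1)[of m] b(1)[of n] b(2)[of m n] that by auto
      then show ?thesis using orthonormal_inner[OF assms(1)] by simp
    qed auto
    show "norm (b n) \<le> 1" for n
      using b(1)[of n] assms by (auto simp: orthonormal_def)
  qed
qed

text \<open>
  The squared distance of \<open>x\<close> to a combination of basis vectors, split into the squared distance to
  the orthogonal projection and the squared deviations of the coefficients from the Fourier
  coefficients. It gives both
  Bessel's inequality and the optimality of the Fourier coefficients used for Parseval's identity.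
\<close>

lemma norm_diff_projection:
  fixes x :: "'h::real_inner"
  assumes "orthonormal E" "finite F" "F \<subseteq> E"
  shows "(norm (x - (\<Sum>e\<in>F. c e *\<^sub>R e)))\<^sup>2 =
    (norm x)\<^sup>2 - (\<Sum>e\<in>F. (x \<bullet> e)\<^sup>2) + (\<Sum>e\<in>F. (x \<bullet> e - c e)\<^sup>2)"
proof -
  let ?p = "\<Sum>e\<in>F. c e *\<^sub>R e"
  have *: "?p \<bullet> f = c f" if "f \<in> F" for f
  proof -
    have "?p \<bullet> f = (\<Sum>e\<in>F. if e = f then c f else 0)"
      unfolding inner_sum_left using assms that
      by (intro sum.cong refl) (auto simp: orthonormal_inner[OF assms(1)] subset_iff)
    then show ?thesis using that assms by simp
  qed
  have "?p \<bullet> ?p = (\<Sum>f\<in>F. c f * (?p \<bullet> f))"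
    by (simp only: inner_sum_right inner_scaleR_right)
  also have "\<dots> = (\<Sum>f\<in>F. (c f)\<^sup>2)"
    by (simp add: * power2_eq_square)
  finally have pp: "?p \<bullet> ?p = (\<Sum>f\<in>F. (c f)\<^sup>2)" .
  have xp: "x \<bullet> ?p = (\<Sum>f\<in>F. c f * (x \<bullet> f))" by (simp add: inner_sum_right)
  have "(norm (x - ?p))\<^sup>2 = (norm x)\<^sup>2 - 2 * (x \<bullet> ?p) + ?p \<bullet> ?p"
    by (simp add: power2_norm_eq_inner inner_diff inner_commute)
  also have "\<dots> = (norm x)\<^sup>2 + (\<Sum>f\<in>F. (x \<bullet> f - c f)\<^sup>2 - (x \<bullet> f)\<^sup>2)"
    unfolding xp pp power2_diff by (simp add: sum_subtractf sum.distrib sum_distrib_left mult_ac)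
  finally show ?thesis by (simp add: sum_subtractf)
qed

lemma Bessel:
  fixes x :: "'h::real_inner"
  assumes "orthonormal E" "finite F" "F \<subseteq> E"
  shows "(\<Sum>e\<in>F. (x \<bullet> e)\<^sup>2) \<le> (norm x)\<^sup>2"
  using norm_diff_projection[OF assms, of x "\<lambda>e. x \<bullet> e"]
  by simp (metis diff_ge_0_iff_ge zero_le_power2)

lemma summable_on_Fourier_coefficients:
  fixes x :: "'h::real_inner"
  assumes "orthonormal E"
  shows "(\<lambda>e. (x \<bullet> e)\<^sup>2) summable_on E"
  by (rule nonneg_bdd_above_summable_on)
    (auto intro!: bdd_aboveI[where M = "(norm x)\<^sup>2"] Bessel[OF assms])

text \<open>
  A summable family has countable support.
\<close>

lemma countable_nonorthogonal:
  fixes x :: "'h::real_inner"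
  assumes "orthonormal E"
  shows "countable {e\<in>E. x \<bullet> e \<noteq> 0}"
  using summable_countable_real[OF summable_on_Fourier_coefficients[OF assms, of x]] by simp

lemma orthonormal_basis_iff:
  "orthonormal_basis E \<longleftrightarrow> orthonormal E \<and> closure (span E) = UNIV"
  by (auto simp: orthonormal_basis_def orthonormal_def)

text \<open>
  The upper bound is Bessel's inequality. For the lower bound, \<open>x\<close> is close to some finite combination
  of basis vectors, and replacing its coefficients by the Fourier coefficients only brings it closer.
\<close>

lemma Parseval:
  fixes x :: "'h::real_inner"
  assumes "orthonormal_basis E"
  shows "((\<lambda>e. (x \<bullet> e)\<^sup>2) has_sum (norm x)\<^sup>2) E"
proof -
  have on: "orthonormal E" and dense: "closure (span E) = UNIV"
    using assms by (auto simp: orthonormal_basis_iff)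
  let ?g = "\<lambda>e. (x \<bullet> e)\<^sup>2"
  let ?S = "infsum ?g E"
  have hs: "(?g has_sum ?S) E"
    using summable_on_Fourier_coefficients[OF on] by simp
  have "?S \<le> (norm x)\<^sup>2"
    by (rule has_sum_le_finite_sums[OF hs]) (rule Bessel[OF on])
  moreover have "(norm x)\<^sup>2 \<le> ?S + d" if "d > 0" for d
  proof -
    obtain y where y: "y \<in> span E" "dist y x < sqrt d"
      using dense \<open>d > 0\<close> closure_approachable[of x "span E"] by (metis UNIV_I real_sqrt_gt_0_iff)
    then obtain F c where F: "finite F" "F \<subseteq> E" "y = (\<Sum>e\<in>F. c e *\<^sub>R e)"
      unfolding span_explicit by blast
    have "(norm x)\<^sup>2 - (\<Sum>e\<in>F. ?g e) \<le> (norm (x - y))\<^sup>2"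
      unfolding F(3) norm_diff_projection[OF on F(1,2)] by (simp add: sum_nonneg)
    moreover have "(norm (x - y))\<^sup>2 \<le> d"
      using y(2) \<open>d > 0\<close> by (simp add: dist_norm norm_minus_commute real_le_rsqrt sqrt_ge_absD less_imp_le)
    moreover have "(\<Sum>e\<in>F. ?g e) \<le> ?S"
      using finite_sum_le_has_sum[OF hs F(1,2)] by auto
    ultimately show ?thesis by linarith
  qed
  ultimately have "?S = (norm x)\<^sup>2"
    by (metis antisym field_le_epsilon)
  then show ?thesis using hs by simp
qed

text \<open>
  The projection onto the closed span of an orthonormal set, possibly uncountable, is its Fourier
  series, which has only countably many nonzero terms.
\<close>

lemma orthonormal_residual:
  fixes x :: "'h::{real_inner,complete_space}"
  assumes "orthonormal E"
  obtains p where "p \<in> closure (span E)" "\<And>e. e \<in> E \<Longrightarrow> (x - p) \<bullet> e = 0"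
proof -
  define C where "C = {e\<in>E. x \<bullet> e \<noteq> 0}"
  have on: "orthonormal C"
    using assms by (auto simp: C_def orthonormal_def pairwise_def)
  obtain b :: "nat \<Rightarrow> 'h" where b: "\<And>n. b n \<in> insert 0 C" "C \<subseteq> range b"
    "\<And>m n. m \<noteq> n \<Longrightarrow> b m \<bullet> b n = 0" "\<And>n. norm (b n) \<le> 1"
    "\<And>(g :: 'h \<Rightarrow> real) s. g 0 = 0 \<Longrightarrow> (g has_sum s) C \<longleftrightarrow> ((\<lambda>n. g (b n)) has_sum s) UNIV"
    by (rule orthonormal_enumerate[OF on]) (auto simp: C_def countable_nonorthogonal[OF assms])
  have "((\<lambda>e. (x \<bullet> e)\<^sup>2) has_sum infsum (\<lambda>e. (x \<bullet> e)\<^sup>2) C) C"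
    using summable_on_Fourier_coefficients[OF on] by simp
  then have sm: "summable (\<lambda>n. (x \<bullet> b n)\<^sup>2)"
    by (subst (asm) b(5)) (auto dest: has_sum_imp_sums sums_summable)
  define p where "p = (\<Sum>n. (x \<bullet> b n) *\<^sub>R b n)"
  have "(\<lambda>n. (x \<bullet> b n) *\<^sub>R b n) sums p"
    using summable_orthogonal_series[OF b(3,4) sm] unfolding p_def by auto
  then have lim: "(\<lambda>n. \<Sum>k<n. (x \<bullet> b k) *\<^sub>R b k) \<longlonglongrightarrow> p"
    by (simp add: sums_def)
  have bspan: "b n \<in> span E" for n
    using b(1)[of n] by (auto simp: C_def span_zero intro: span_base)
  show thesis
  proof
    show "p \<in> closure (span E)"
      unfolding closure_sequential
    proof (intro exI conjI allI)
      show "(\<Sum>k<n. (x \<bullet> b k) *\<^sub>R b k) \<in> span E" for n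
        by (intro span_sum span_scale bspan)
    qed (rule lim)
    show "(x - p) \<bullet> e = 0" if "e \<in> E" for e
    proof (cases "e \<in> C")
      case True
      then obtain m where m: "b m = e" using b(2) by auto
      have "norm e = 1" using True on by (auto simp: orthonormal_def)
      then show ?thesis
        using inner_orthogonal_series[where b = b and c = "\<lambda>n. x \<bullet> b n" and m = m, OF b(3,4) sm] m
        by (simp add: p_def inner_diff_left)
    next
      case False
      have "b k \<bullet> e = 0" for k
        using b(1)[of k] False that orthonormal_inner[OF assms, of "b k" e] by (auto simp: C_def)
      then have "(\<lambda>n. (\<Sum>k<n. (x \<bullet> b k) *\<^sub>R b k) \<bullet> e) = (\<lambda>n. 0)"
        by (simp add: inner_sum_left)
      then have "(\<lambda>n. 0) \<longlonglongrightarrow> p \<bullet> e"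
        using tendsto_inner[OF lim tendsto_const[of e]] by simp
      then have "p \<bullet> e = 0"
        using LIMSEQ_unique tendsto_const by blast
      then show ?thesis using False that by (simp add: C_def inner_diff_left)
    qed
  qed
qed

text \<open>
  By Zorn's lemma there is a maximal orthonormal set. If some \<open>x\<close> were outside its closed span, the
  normalised difference of \<open>x\<close> and its projection would extend the set.
\<close>

lemma orthonormal_basis_exists:
  "\<exists>E :: 'h::{real_inner,complete_space} set. orthonormal_basis E"
proof -
  have "\<exists>M\<in>Collect orthonormal. \<forall>X\<in>Collect orthonormal. M \<subseteq> X \<longrightarrow> X = (M :: 'h set)"
  proof (rule subset_Zorn')
    fix \<C> :: "'h set set" assume C: "subset.chain (Collect orthonormal) \<C>"
    have "orthogonal x y" if "x \<in> \<Union>\<C>" "y \<in> \<Union>\<C>" "x \<noteq> y" for x y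
    proof -
      obtain X Y where XY: "X \<in> \<C>" "x \<in> X" "Y \<in> \<C>" "y \<in> Y"
        using \<open>x \<in> \<Union>\<C>\<close> \<open>y \<in> \<Union>\<C>\<close> by auto
      then have "X \<subseteq> Y \<or> Y \<subseteq> X"
        using C unfolding subset_chain_def by auto
      then obtain X where "X \<in> \<C>" "x \<in> X" "y \<in> X"
        using XY by auto
      then show ?thesis using C that
        by (auto simp: subset_chain_def orthonormal_def pairwise_def)
    qed
    then show "\<Union>\<C> \<in> Collect orthonormal"
      using C by (auto simp: orthonormal_def pairwise_def subset_chain_def)
  qed
  then obtain E :: "'h set" where on: "orthonormal E"
    and max: "\<And>X. orthonormal X \<Longrightarrow> E \<subseteq> X \<Longrightarrow> X = E" by auto
  have "x \<in> closure (span E)" for x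
  proof -
    obtain p where p: "p \<in> closure (span E)" and res: "\<And>e. e \<in> E \<Longrightarrow> (x - p) \<bullet> e = 0"
      using orthonormal_residual[OF on] by blast
    have "x = p"
    proof (rule ccontr)
      assume "x \<noteq> p"
      define u where "u = (1 / norm (x - p)) *\<^sub>R (x - p)"
      have u: "norm u = 1" "\<And>e. e \<in> E \<Longrightarrow> u \<bullet> e = 0"
        using \<open>x \<noteq> p\<close> res by (auto simp: u_def)
      then have "orthonormal (insert u E)"
        using on by (auto simp: orthonormal_def pairwise_insert orthogonal_def inner_commute)
      then have "u \<in> E" using max by blast
      then show False using u by (metis inner_eq_zero_iff norm_zero zero_neq_one)
    qed
    then show ?thesis using p by simp
  qed
  then show ?thesis using on by (auto simp: orthonormal_basis_iff)
qed

section \<open>Bochner measurable functions\<close>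

lemma ae_simple_if_simple_function:
  assumes "simple_function M s"
  shows "ae_simple M (s :: 'a \<Rightarrow> 'h::real_normed_vector)"
proof -
  let ?R = "s ` space M"
  have fin: "finite ?R" using assms by (simp add: simple_function_def)
  then obtain h where h: "bij_betw h {1..card ?R} ?R"
    using ex_bij_betw_nat_finite_1 by blast
  let ?E = "\<lambda>n. s -` {h n} \<inter> space M"
  have "s \<omega> = (\<Sum>n=1..card ?R. indicator (?E n) \<omega> *\<^sub>R h n)" if "\<omega> \<in> space M" for \<omega>
  proof -
    have "(\<Sum>n=1..card ?R. indicator (?E n) \<omega> *\<^sub>R h n) = (\<Sum>y\<in>?R. indicator (s -` {y} \<inter> space M) \<omega> *\<^sub>R y)"
      by (rule sum.reindex_bij_betw[OF h])
    also have "\<dots> = (\<Sum>y\<in>?R. if y = s \<omega> then y else 0)"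
      using that by (intro sum.cong) (auto simp: indicator_def)
    also have "\<dots> = s \<omega>" using fin that by simp
    finally show ?thesis by simp
  qed
  moreover have "?E n \<in> sets M" for n
    using simple_functionD(2)[OF assms] .
  ultimately show ?thesis
    unfolding ae_simple_def by (intro exI[of _ "card ?R"] exI[of _ ?E] exI[of _ h]) auto
qed

lemma simple_function_if_ae_simple:
  assumes "ae_simple M (v :: 'a \<Rightarrow> 'h::real_normed_vector)"
  obtains s where "simple_function M s" "AE \<omega> in M. v \<omega> = s \<omega>"
proof -
  obtain N :: nat and E e where E: "\<forall>n\<in>{1..N}. E n \<in> sets M"
    "AE \<omega> in M. v \<omega> = (\<Sum>n=1..N. indicator (E n) \<omega> *\<^sub>R e n)"
    using assms unfolding ae_simple_def by blast
  have "simple_function M (\<lambda>\<omega>. indicator (E n) \<omega> *\<^sub>R e n)" if "n \<in> {1..N}" for n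
    using simple_function_compose1[OF simple_function_indicator, of "E n" M "\<lambda>r :: real. r *\<^sub>R e n"] E that
    by auto
  then have "simple_function M (\<lambda>\<omega>. \<Sum>n=1..N. indicator (E n) \<omega> *\<^sub>R e n)"
    by (intro simple_function_sum) auto
  then show thesis using that E(2) by blast
qed

text \<open>
  Countably many exceptional null sets can be discarded together, so the approximating functions may
  be taken to be simple everywhere.
\<close>

lemma bochner_measurable_iff:
  "bochner_measurable M (v :: 'a \<Rightarrow> 'h::real_normed_vector) \<longleftrightarrow>
    (\<exists>s. (\<forall>n. simple_function M (s n)) \<and> (AE \<omega> in M. (\<lambda>n. s n \<omega>) \<longlonglongrightarrow> v \<omega>))"
proof
  assume "bochner_measurable M v"
  then obtain s where s: "\<And>n. ae_simple M (s n)"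
    "AE \<omega> in M. (\<lambda>n. norm (s n \<omega> - v \<omega>)) \<longlonglongrightarrow> 0"
    unfolding bochner_measurable_def by auto
  have "\<forall>n. \<exists>t. simple_function M t \<and> (AE \<omega> in M. s n \<omega> = t \<omega>)"
    using simple_function_if_ae_simple[OF s(1)] by metis
  then obtain t where t: "\<And>n. simple_function M (t n)" "\<And>n. AE \<omega> in M. s n \<omega> = t n \<omega>"
    by metis
  have "AE \<omega> in M. \<forall>n. s n \<omega> = t n \<omega>" using t(2) by (simp add: AE_all_countable)
  with s(2) have "AE \<omega> in M. (\<lambda>n. t n \<omega>) \<longlonglongrightarrow> v \<omega>"
    by eventually_elim (simp add: tendsto_norm_zero_iff LIM_zero_cancel)
  then show "\<exists>s. (\<forall>n. simple_function M (s n)) \<and> (AE \<omega> in M. (\<lambda>n. s n \<omega>) \<longlonglongrightarrow> v \<omega>)"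
    using t(1) by blast
next
  assume "\<exists>s. (\<forall>n. simple_function M (s n)) \<and> (AE \<omega> in M. (\<lambda>n. s n \<omega>) \<longlonglongrightarrow> v \<omega>)"
  then show "bochner_measurable M v"
    unfolding bochner_measurable_def tendsto_norm_zero_iff LIM_zero_iff
    using ae_simple_if_simple_function by metis
qed

lemma bochner_measurable_add:
  assumes "bochner_measurable M v" "bochner_measurable M w"
  shows "bochner_measurable M (\<lambda>\<omega>. v \<omega> + w \<omega>)"
proof -
  obtain s t where s: "\<And>n. simple_function M (s n)" "AE \<omega> in M. (\<lambda>n. s n \<omega>) \<longlonglongrightarrow> v \<omega>"
    and t: "\<And>n. simple_function M (t n)" "AE \<omega> in M. (\<lambda>n. t n \<omega>) \<longlonglongrightarrow> w \<omega>"
    using assms unfolding bochner_measurable_iff by blast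
  have "AE \<omega> in M. (\<lambda>n. s n \<omega> + t n \<omega>) \<longlonglongrightarrow> v \<omega> + w \<omega>"
    using s(2) t(2) by eventually_elim (rule tendsto_add)
  moreover have "simple_function M (\<lambda>\<omega>. s n \<omega> + t n \<omega>)" for n
    using s(1) t(1) by (rule simple_function_add)
  ultimately show ?thesis unfolding bochner_measurable_iff
    by (intro exI[of _ "\<lambda>n \<omega>. s n \<omega> + t n \<omega>"]) simp
qed

lemma bochner_measurable_scaleR:
  assumes "bochner_measurable M v"
  shows "bochner_measurable M (\<lambda>\<omega>. c *\<^sub>R v \<omega>)"
proof -
  obtain s where s: "\<And>n. simple_function M (s n)" "AE \<omega> in M. (\<lambda>n. s n \<omega>) \<longlonglongrightarrow> v \<omega>"
    using assms unfolding bochner_measurable_iff by blast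
  have "AE \<omega> in M. (\<lambda>n. c *\<^sub>R s n \<omega>) \<longlonglongrightarrow> c *\<^sub>R v \<omega>"
    using s(2) by eventually_elim (intro tendsto_intros)
  moreover have "simple_function M (\<lambda>\<omega>. c *\<^sub>R s n \<omega>)" for n
    using simple_function_compose1[OF s(1)] .
  ultimately show ?thesis unfolding bochner_measurable_iff
    by (intro exI[of _ "\<lambda>n \<omega>. c *\<^sub>R s n \<omega>"]) simp
qed

text \<open>
  The preimages under \<open>f\<close> and \<open>g\<close> differ by a subset of a null set, which is measurable by
  completeness.
\<close>

lemma (in complete_measure) measurable_if_AE_eq:
  assumes g: "g \<in> measurable M N" and f: "f \<in> space M \<rightarrow> space N"
    and ae: "AE \<omega> in M. f \<omega> = g \<omega>"
  shows "f \<in> measurable M N"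
proof (rule measurableI)
  show "f x \<in> space N" if "x \<in> space M" for x using f that by auto
  fix A assume A: "A \<in> sets N"
  obtain Z where Z: "Z \<in> null_sets M" "{\<omega>\<in>space M. f \<omega> \<noteq> g \<omega>} \<subseteq> Z"
    using ae by (auto simp: eventually_ae_filter)
  have "f -` A \<inter> Z \<inter> space M \<in> sets M"
    by (rule complete[OF _ Z(1)]) auto
  moreover have "f -` A \<inter> space M = (g -` A \<inter> space M - Z) \<union> (f -` A \<inter> Z \<inter> space M)"
    using Z(2) by auto
  ultimately show "f -` A \<inter> space M \<in> sets M"
    using measurable_sets[OF g A] Z(1) by (metis null_setsD2 sets.Diff sets.Un)
qed

lemma (in complete_measure) borel_measurable_AE_limit:
  fixes f :: "'a \<Rightarrow> real"
  assumes "\<And>n. s n \<in> borel_measurable M" "AE \<omega> in M. (\<lambda>n. s n \<omega>) \<longlonglongrightarrow> f \<omega>"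
  shows "f \<in> borel_measurable M"
proof (rule measurable_if_AE_eq)
  show "(\<lambda>\<omega>. lim (\<lambda>n. s n \<omega>)) \<in> borel_measurable M"
    using assms(1) by (rule borel_measurable_lim_metric)
  show "AE \<omega> in M. f \<omega> = lim (\<lambda>n. s n \<omega>)"
    using assms(2) by eventually_elim (simp add: limI)
qed auto

lemma (in complete_measure) borel_measurable_bochner_compose:
  fixes \<phi> :: "'h::real_normed_vector \<Rightarrow> real"
  assumes "bochner_measurable M v" "continuous_on UNIV \<phi>"
  shows "(\<lambda>\<omega>. \<phi> (v \<omega>)) \<in> borel_measurable M"
proof -
  obtain s where s: "\<And>n. simple_function M (s n)" "AE \<omega> in M. (\<lambda>n. s n \<omega>) \<longlonglongrightarrow> v \<omega>"
    using assms(1) unfolding bochner_measurable_iff by blast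
  show ?thesis
  proof (rule borel_measurable_AE_limit)
    show "(\<lambda>\<omega>. \<phi> (s n \<omega>)) \<in> borel_measurable M" for n
      using simple_function_compose1[OF s(1)] by (rule borel_measurable_simple_function)
    show "AE \<omega> in M. (\<lambda>n. \<phi> (s n \<omega>)) \<longlonglongrightarrow> \<phi> (v \<omega>)"
      using s(2) by eventually_elim
        (metis assms(2) continuous_on_eq_continuous_at isCont_tendsto_compose open_UNIV UNIV_I)
  qed
qed

lemma square_sum_le: "(norm (x + y :: 'b::real_normed_vector))\<^sup>2 \<le> 2 * (norm x)\<^sup>2 + 2 * (norm y)\<^sup>2"
proof -
  have "(norm (x + y))\<^sup>2 \<le> (norm x + norm y)\<^sup>2" by (intro power_mono norm_triangle_ineq) simp
  also have "\<dots> \<le> 2 * (norm x)\<^sup>2 + 2 * (norm y)\<^sup>2"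
    using sum_squares_bound[of "norm x" "norm y"] by (simp add: power2_sum)
  finally show ?thesis .
qed

lemma bochner_square_integrable_scaleR:
  "v \<in> bochner_square_integrable M \<Longrightarrow> (\<lambda>\<omega>. c *\<^sub>R v \<omega>) \<in> bochner_square_integrable M"
  by (auto simp: bochner_square_integrable_def bochner_measurable_scaleR power_mult_distrib)

lemma (in complete_measure) bochner_square_integrable_add:
  fixes v w :: "'a \<Rightarrow> 'h::real_inner"
  assumes "v \<in> bochner_square_integrable M" "w \<in> bochner_square_integrable M"
  shows "(\<lambda>\<omega>. v \<omega> + w \<omega>) \<in> bochner_square_integrable M"
proof -
  have bm: "bochner_measurable M (\<lambda>\<omega>. v \<omega> + w \<omega>)"
    using assms by (auto simp: bochner_square_integrable_def bochner_measurable_add)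
  moreover have "integrable M (\<lambda>\<omega>. (norm (v \<omega> + w \<omega>))\<^sup>2)"
  proof (rule Bochner_Integration.integrable_bound)
    show "integrable M (\<lambda>\<omega>. 2 * (norm (v \<omega>))\<^sup>2 + 2 * (norm (w \<omega>))\<^sup>2)"
      using assms by (auto simp: bochner_square_integrable_def)
    show "(\<lambda>\<omega>. (norm (v \<omega> + w \<omega>))\<^sup>2) \<in> borel_measurable M"
      by (rule borel_measurable_bochner_compose[OF bm]) (intro continuous_intros)
  qed (simp add: square_sum_le)
  ultimately show ?thesis by (simp add: bochner_square_integrable_def)
qed

lemma real_square_integrable_scaleR:
  "f \<in> real_square_integrable M \<Longrightarrow> (\<lambda>\<omega>. c *\<^sub>R f \<omega>) \<in> real_square_integrable M"
  by (auto simp: real_square_integrable_def power_mult_distrib)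

lemma real_square_integrable_add:
  assumes "f \<in> real_square_integrable M" "g \<in> real_square_integrable M"
  shows "(\<lambda>\<omega>. f \<omega> + g \<omega>) \<in> real_square_integrable M"
proof -
  have [measurable]: "f \<in> borel_measurable M" "g \<in> borel_measurable M"
    using assms by (auto simp: real_square_integrable_def)
  have "integrable M (\<lambda>\<omega>. (f \<omega> + g \<omega>)\<^sup>2)"
  proof (rule Bochner_Integration.integrable_bound)
    show "integrable M (\<lambda>\<omega>. 2 * (f \<omega>)\<^sup>2 + 2 * (g \<omega>)\<^sup>2)"
      using assms by (auto simp: real_square_integrable_def)
  qed (use square_sum_le[of "f _" "g _"] in auto)
  then show ?thesis by (simp add: real_square_integrable_def)
qed

lemma (in complete_measure) inner_square_integrable:
  fixes v :: "'a \<Rightarrow> 'h::real_inner"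
  assumes "v \<in> bochner_square_integrable M"
  shows "(\<lambda>\<omega>. v \<omega> \<bullet> x) \<in> real_square_integrable M"
    and "(\<integral>\<omega>. (v \<omega> \<bullet> x)\<^sup>2 \<partial>M) \<le> (\<integral>\<omega>. (norm (v \<omega>))\<^sup>2 \<partial>M) * (norm x)\<^sup>2"
proof -
  have int: "integrable M (\<lambda>\<omega>. (norm (v \<omega>))\<^sup>2 * (norm x)\<^sup>2)"
    using assms by (simp add: bochner_square_integrable_def)
  have le: "(v \<omega> \<bullet> x)\<^sup>2 \<le> (norm (v \<omega>))\<^sup>2 * (norm x)\<^sup>2" for \<omega>
    using Cauchy_Schwarz_ineq[of "v \<omega>" x] by (simp add: power2_norm_eq_inner)
  have m: "(\<lambda>\<omega>. v \<omega> \<bullet> x) \<in> borel_measurable M"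
    using assms by (intro borel_measurable_bochner_compose)
      (auto simp: bochner_square_integrable_def intro!: continuous_intros)
  have "integrable M (\<lambda>\<omega>. (v \<omega> \<bullet> x)\<^sup>2)"
    by (rule Bochner_Integration.integrable_bound[OF int]) (use m le in auto)
  then show "(\<lambda>\<omega>. v \<omega> \<bullet> x) \<in> real_square_integrable M"
    and "(\<integral>\<omega>. (v \<omega> \<bullet> x)\<^sup>2 \<partial>M) \<le> (\<integral>\<omega>. (norm (v \<omega>))\<^sup>2 \<partial>M) * (norm x)\<^sup>2"
    using m integral_mono[OF _ int le] by (auto simp: real_square_integrable_def)
qed

text \<open>
  Each approximating simple function has finite range, so the union of the ranges is countable.
\<close>

lemma bochner_measurable_essentially_separable:
  fixes v :: "'a \<Rightarrow> 'h::real_normed_vector"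
  assumes "bochner_measurable M v"
  obtains D where "countable D" "AE \<omega> in M. v \<omega> \<in> closure D"
proof -
  obtain s where s: "\<And>n. simple_function M (s n)" "AE \<omega> in M. (\<lambda>n. s n \<omega>) \<longlonglongrightarrow> v \<omega>"
    using assms unfolding bochner_measurable_iff by blast
  let ?D = "\<Union>n. s n ` space M"
  have "countable ?D"
    using simple_functionD(1)[OF s(1)] by (auto intro: countable_finite)
  moreover have "AE \<omega> in M. v \<omega> \<in> closure ?D"
    using s(2) AE_space
  proof eventually_elim
    case (elim \<omega>)
    then show ?case unfolding closure_sequential by (intro exI[of _ "\<lambda>n. s n \<omega>"]) auto
  qed
  ultimately show thesis by (rule that)
qed

text \<open>
  A vector in the closure of a countable set \<open>D\<close> is orthogonal to every basis vector that is orthogonal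
  to all of \<open>D\<close>, and only countably many basis vectors fail to be so. The exceptional null set is
  independent of the basis vector, which matters because there are uncountably many of them.
\<close>

lemma bochner_measurable_countably_many_coefficients:
  fixes v :: "'a \<Rightarrow> 'h::real_inner"
  assumes "orthonormal E" "bochner_measurable M v"
  obtains C where "countable C" "C \<subseteq> E" "AE \<omega> in M. \<forall>e\<in>E - C. v \<omega> \<bullet> e = 0"
proof -
  obtain D where D: "countable D" "AE \<omega> in M. v \<omega> \<in> closure D"
    using bochner_measurable_essentially_separable[OF assms(2)] .
  define C where "C = (\<Union>d\<in>D. {e\<in>E. d \<bullet> e \<noteq> 0})"
  have "countable C"
    using D(1) countable_nonorthogonal[OF assms(1)] by (auto simp: C_def)
  moreover have "closure D \<subseteq> {y. y \<bullet> e = 0}" if "e \<in> E - C" for e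
  proof (rule closure_minimal)
    show "D \<subseteq> {y. y \<bullet> e = 0}" using that by (auto simp: C_def)
    show "closed {y. y \<bullet> e = 0}" by (intro closed_Collect_eq continuous_intros)
  qed
  then have "AE \<omega> in M. \<forall>e\<in>E - C. v \<omega> \<bullet> e = 0"
    using D(2) by (auto elim!: eventually_mono)
  moreover have "C \<subseteq> E" by (auto simp: C_def)
  ultimately show thesis by (intro that)
qed

text \<open>
  Pointwise Parseval's identity involves only the countably many basis vectors of the previous lemma,
  so it can be integrated termwise. For the remaining basis vectors the integral is zero.
\<close>

lemma (in complete_measure) integrated_Parseval:
  fixes v :: "'a \<Rightarrow> 'h::real_inner"
  assumes E: "orthonormal_basis E" and v: "v \<in> bochner_square_integrable M"
  shows "((\<lambda>e. \<integral>\<omega>. (v \<omega> \<bullet> e)\<^sup>2 \<partial>M) has_sum (\<integral>\<omega>. (norm (v \<omega>))\<^sup>2 \<partial>M)) E"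
proof -
  have on: "orthonormal E" using E by (simp add: orthonormal_basis_iff)
  have bm: "bochner_measurable M v" and iv: "integrable M (\<lambda>\<omega>. (norm (v \<omega>))\<^sup>2)"
    using v by (auto simp: bochner_square_integrable_def)
  obtain C where C: "countable C" "C \<subseteq> E" "AE \<omega> in M. \<forall>e\<in>E - C. v \<omega> \<bullet> e = 0"
    using bochner_measurable_countably_many_coefficients[OF on bm] .
  have onC: "orthonormal C" using on C(2) by (auto simp: orthonormal_def pairwise_def)
  obtain b :: "nat \<Rightarrow> 'h" where b: "\<And>n. b n \<in> insert 0 C" "C \<subseteq> range b"
    "\<And>m n. m \<noteq> n \<Longrightarrow> b m \<bullet> b n = 0" "\<And>n. norm (b n) \<le> 1"
    "\<And>(g :: 'h \<Rightarrow> real) s. g 0 = 0 \<Longrightarrow> (g has_sum s) C \<longleftrightarrow> ((\<lambda>n. g (b n)) has_sum s) UNIV"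
    by (rule orthonormal_enumerate[OF onC C(1)]) blast
  let ?q = "\<lambda>e. \<integral>\<omega>. (v \<omega> \<bullet> e)\<^sup>2 \<partial>M"
  have AE_sums: "AE \<omega> in M. (\<lambda>n. (v \<omega> \<bullet> b n)\<^sup>2) sums (norm (v \<omega>))\<^sup>2"
    using C(3)
  proof eventually_elim
    case (elim \<omega>)
    have "((\<lambda>e. (v \<omega> \<bullet> e)\<^sup>2) has_sum (norm (v \<omega>))\<^sup>2) C"
      using Parseval[OF E, of "v \<omega>"] elim C(2)
      by (subst has_sum_cong_neutral[of E C]) auto
    then show ?case by (subst (asm) b(5)) (auto dest: has_sum_imp_sums)
  qed
  have int: "integrable M (\<lambda>\<omega>. (v \<omega> \<bullet> x)\<^sup>2)" for x
    using inner_square_integrable(1)[OF v, of x] by (simp add: real_square_integrable_def)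
  have sm: "summable (\<lambda>n. ?q (b n))"
  proof (rule summableI_nonneg_bounded)
    show "(\<Sum>n<k. ?q (b n)) \<le> (\<integral>\<omega>. (norm (v \<omega>))\<^sup>2 \<partial>M)" for k
    proof -
      have "(\<Sum>n<k. ?q (b n)) = (\<integral>\<omega>. (\<Sum>n<k. (v \<omega> \<bullet> b n)\<^sup>2) \<partial>M)"
        using int by simp
      also have "\<dots> \<le> (\<integral>\<omega>. (norm (v \<omega>))\<^sup>2 \<partial>M)"
      proof (rule integral_mono_AE)
        show "AE \<omega> in M. (\<Sum>n<k. (v \<omega> \<bullet> b n)\<^sup>2) \<le> (norm (v \<omega>))\<^sup>2"
          using AE_sums by eventually_elim (metis finite_lessThan sum_le_suminf sums_iff zero_le_power2)
      qed (use int iv in auto)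
      finally show ?thesis .
    qed
  qed simp
  have "(\<lambda>n. ?q (b n)) sums (\<integral>\<omega>. (\<Sum>n. (v \<omega> \<bullet> b n)\<^sup>2) \<partial>M)"
    using AE_sums sm int by (intro sums_integral) (auto simp: sums_iff elim!: eventually_mono)
  also have "(\<integral>\<omega>. (\<Sum>n. (v \<omega> \<bullet> b n)\<^sup>2) \<partial>M) = (\<integral>\<omega>. (norm (v \<omega>))\<^sup>2 \<partial>M)"
  proof (rule integral_cong_AE)
    show "(\<lambda>\<omega>. \<Sum>n. (v \<omega> \<bullet> b n)\<^sup>2) \<in> borel_measurable M"
      using int by (intro borel_measurable_suminf) auto
    show "AE \<omega> in M. (\<Sum>n. (v \<omega> \<bullet> b n)\<^sup>2) = (norm (v \<omega>))\<^sup>2"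
      using AE_sums by eventually_elim (simp add: sums_iff)
  qed (use iv in auto)
  finally have "((\<lambda>n. ?q (b n)) has_sum (\<integral>\<omega>. (norm (v \<omega>))\<^sup>2 \<partial>M)) UNIV"
    by (rule sums_nonneg_imp_has_sum) simp
  then have "(?q has_sum (\<integral>\<omega>. (norm (v \<omega>))\<^sup>2 \<partial>M)) C"
    by (subst b(5)) auto
  moreover have "?q e = 0" if "e \<in> E - C" for e
  proof (rule integral_eq_zero_AE)
    show "AE \<omega> in M. (v \<omega> \<bullet> e)\<^sup>2 = 0"
      using C(3) by eventually_elim (use that in auto)
  qed
  ultimately show ?thesis
    using C(2) by (subst has_sum_cong_neutral[of C E]) auto
qed

section \<open>Classes of functions equal almost everywhere\<close>

lemma ae_class_eq_iff:
  "f \<in> S \<Longrightarrow> g \<in> S \<Longrightarrow> ae_class M S f = ae_class M S g \<longleftrightarrow> (AE \<omega> in M. f \<omega> = g \<omega>)"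
  unfolding ae_class_def
  using eq_equiv_class_iff[OF equiv_ae_rel, of f S g M] by (auto simp: ae_rel_def)

lemma ae_class_in_quotient: "f \<in> S \<Longrightarrow> ae_class M S f \<in> S // ae_rel M S"
  unfolding ae_class_def by (rule quotientI)

lemma rep_in_quotient_class:
  assumes "A \<in> S // ae_rel M S"
  shows rep_in: "rep A \<in> S" and ae_class_rep: "ae_class M S (rep A) = A"
proof -
  have "rep A \<in> A"
    unfolding rep_def using in_quotient_imp_non_empty[OF equiv_ae_rel assms] by (simp add: some_in_eq)
  then show "rep A \<in> S"
    using in_quotient_imp_subset[OF equiv_ae_rel assms] by auto
  obtain f where f: "A = ae_rel M S `` {f}"
    using assms by (rule quotientE)
  then have "(f, rep A) \<in> ae_rel M S" using \<open>rep A \<in> A\<close> by simp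
  then show "ae_class M S (rep A) = A"
    unfolding ae_class_def f using equiv_class_eq[OF equiv_ae_rel] by metis
qed

lemma AE_rep_ae_class:
  assumes "f \<in> S"
  shows "AE \<omega> in M. rep (ae_class M S f) \<omega> = f \<omega>"
  using ae_class_eq_iff[OF rep_in[OF ae_class_in_quotient[OF assms]] assms, of M M]
    ae_class_rep[OF ae_class_in_quotient[OF assms], of M] by simp

lemma vcarrier_l2 [simp]: "vcarrier (l2_structure M S) = S // ae_rel M S"
  by (simp add: l2_structure_def)

lemma vadd_ae_class:
  assumes closed: "\<And>f g. f \<in> S \<Longrightarrow> g \<in> S \<Longrightarrow> (\<lambda>\<omega>. f \<omega> + g \<omega>) \<in> S"
    and "f \<in> S" "g \<in> S"
  shows "vadd (l2_structure M S) (ae_class M S f) (ae_class M S g) = ae_class M S (\<lambda>\<omega>. f \<omega> + g \<omega>)"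
proof -
  have "AE \<omega> in M. rep (ae_class M S f) \<omega> + rep (ae_class M S g) \<omega> = f \<omega> + g \<omega>"
    using AE_rep_ae_class[OF assms(2), of M] AE_rep_ae_class[OF assms(3), of M]
    by eventually_elim simp
  then show ?thesis
    by (simp add: l2_structure_def)
      (subst ae_class_eq_iff, auto intro!: closed rep_in[OF ae_class_in_quotient] assms)
qed

lemma vscale_ae_class:
  assumes closed: "\<And>f. f \<in> S \<Longrightarrow> (\<lambda>\<omega>. c *\<^sub>R f \<omega>) \<in> S" and "f \<in> S"
  shows "vscale (l2_structure M S) c (ae_class M S f) = ae_class M S (\<lambda>\<omega>. c *\<^sub>R f \<omega>)"
proof -
  have "AE \<omega> in M. c *\<^sub>R rep (ae_class M S f) \<omega> = c *\<^sub>R f \<omega>"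
    using AE_rep_ae_class[OF assms(2), of M] by eventually_elim simp
  then show ?thesis
    by (simp add: l2_structure_def)
      (subst ae_class_eq_iff, auto intro!: closed rep_in[OF ae_class_in_quotient] assms)
qed

lemma vadd_real_class:
  assumes "f \<in> real_square_integrable M" "g \<in> real_square_integrable M"
  shows "vadd (L2_real M) (ae_class M (real_square_integrable M) f) (ae_class M (real_square_integrable M) g) =
    ae_class M (real_square_integrable M) (\<lambda>\<omega>. f \<omega> + g \<omega>)"
  unfolding L2_real_def using real_square_integrable_add assms by (rule vadd_ae_class)

lemma vscale_real_class:
  assumes "f \<in> real_square_integrable M"
  shows "vscale (L2_real M) c (ae_class M (real_square_integrable M) f) =
    ae_class M (real_square_integrable M) (\<lambda>\<omega>. c *\<^sub>R f \<omega>)"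
  unfolding L2_real_def using real_square_integrable_scaleR assms by (rule vscale_ae_class)

lemma vscale_bochner_class:
  assumes "v \<in> bochner_square_integrable M"
  shows "vscale (L2_bochner M) c (ae_class M (bochner_square_integrable M) v) =
    ae_class M (bochner_square_integrable M) (\<lambda>\<omega>. c *\<^sub>R v \<omega>)"
  unfolding L2_bochner_def using bochner_square_integrable_scaleR assms by (rule vscale_ae_class)

lemma (in complete_measure) vadd_bochner_class:
  assumes "v \<in> bochner_square_integrable M" "w \<in> bochner_square_integrable M"
  shows "vadd (L2_bochner M) (ae_class M (bochner_square_integrable M) v) (ae_class M (bochner_square_integrable M) w) =
    ae_class M (bochner_square_integrable M) (\<lambda>\<omega>. v \<omega> + w \<omega>)"
  unfolding L2_bochner_def using bochner_square_integrable_add assms by (rule vadd_ae_class)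

lemma L2_real_class_in:
  "f \<in> real_square_integrable M \<Longrightarrow> ae_class M (real_square_integrable M) f \<in> vcarrier (L2_real M)"
  by (simp add: L2_real_def ae_class_in_quotient)

lemma L2_bochner_class_in:
  "v \<in> bochner_square_integrable M \<Longrightarrow> ae_class M (bochner_square_integrable M) v \<in> vcarrier (L2_bochner M)"
  by (simp add: L2_bochner_def ae_class_in_quotient)

lemma L2_real_rep:
  assumes "A \<in> vcarrier (L2_real M)"
  shows "rep A \<in> real_square_integrable M" "ae_class M (real_square_integrable M) (rep A) = A"
  using rep_in_quotient_class[of A "real_square_integrable M" M] assms by (simp_all add: L2_real_def)

lemma L2_bochner_rep:
  assumes "A \<in> vcarrier (L2_bochner M)"
  shows "rep A \<in> bochner_square_integrable M" "ae_class M (bochner_square_integrable M) (rep A) = A"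
  using rep_in_quotient_class[of A "bochner_square_integrable M" M] assms by (simp_all add: L2_bochner_def)

lemma vnorm_L2_bochner_squared: "(vnorm (L2_bochner M) A)\<^sup>2 = (\<integral>\<omega>. (norm (rep A \<omega>))\<^sup>2 \<partial>M)"
  by (simp add: L2_bochner_def l2_structure_def l2_inner_def dot_square_norm)

lemma vnorm_L2_real_squared: "(vnorm (L2_real M) A)\<^sup>2 = (\<integral>\<omega>. (rep A \<omega>)\<^sup>2 \<partial>M)"
  by (simp add: L2_real_def l2_structure_def l2_inner_def power2_eq_square)

lemma vnorm_L2_nonneg: "0 \<le> vnorm (L2_real M) A" "0 \<le> vnorm (L2_bochner M) B"
  by (simp_all add: L2_real_def L2_bochner_def l2_structure_def l2_inner_def)

lemma vnorm_real_class_squared: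
  assumes "f \<in> real_square_integrable M"
  shows "(vnorm (L2_real M) (ae_class M (real_square_integrable M) f))\<^sup>2 = (\<integral>\<omega>. (f \<omega>)\<^sup>2 \<partial>M)"
  unfolding vnorm_L2_real_squared
proof (rule integral_cong_AE)
  let ?r = "rep (ae_class M (real_square_integrable M) f)"
  have "?r \<in> real_square_integrable M"
    by (rule rep_in[OF ae_class_in_quotient[OF assms]])
  then show "(\<lambda>\<omega>. (?r \<omega>)\<^sup>2) \<in> borel_measurable M" "(\<lambda>\<omega>. (f \<omega>)\<^sup>2) \<in> borel_measurable M"
    using assms by (auto simp: real_square_integrable_def)
  show "AE \<omega> in M. (?r \<omega>)\<^sup>2 = (f \<omega>)\<^sup>2"
    using AE_rep_ae_class[OF assms] by eventually_elim simp
qed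

lemma AE_eq_if_integral_square_zero:
  assumes "f \<in> real_square_integrable M" "(\<integral>\<omega>. (f \<omega>)\<^sup>2 \<partial>M) = 0"
  shows "AE \<omega> in M. f \<omega> = 0"
  using assms integral_nonneg_eq_0_iff_AE[of M "\<lambda>\<omega>. (f \<omega>)\<^sup>2"]
  by (simp add: real_square_integrable_def)

section \<open>Bounded operators into the real space\<close>

text \<open>
  The squared distance of \<open>T x\<close> and \<open>U x\<close> is at most a constant times the squared distance of \<open>x\<close> to
  any point of the span, because \<open>T\<close> and \<open>U\<close> agree there.
\<close>

lemma bounded_linear_into_L2_eqI:
  assumes T: "bounded_linear_into (L2_real M) T" and U: "bounded_linear_into (L2_real M) U"
    and eq: "\<And>e. e \<in> E \<Longrightarrow> T e = U e" and dense: "closure (span E) = UNIV"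
  shows "T = U"
proof
  fix x
  let ?S = "real_square_integrable M"
  have S: "rep (W z) \<in> ?S" "ae_class M ?S (rep (W z)) = W z" if "bounded_linear_into (L2_real M) W" for W z
    using that L2_real_rep[of "W z" M] by (simp_all add: bounded_linear_into_def)
  have span: "T y = U y" if "y \<in> span E" for y
    using that
  proof (induction rule: span_induct)
    have "W 0 = ae_class M ?S (\<lambda>_. 0)" if "bounded_linear_into (L2_real M) W" for W
    proof -
      have "W 0 = vscale (L2_real M) 0 (W 0)"
        using that unfolding bounded_linear_into_def by (metis scaleR_zero_left)
      then show ?thesis by (simp add: L2_real_def l2_structure_def)
    qed
    from this[OF T] this[OF U] have "T 0 = U 0" by simp
    then show "subspace {y. T y = U y}"
      using T U by (simp add: subspace_def bounded_linear_into_def)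
  qed (rule eq)
  have "\<exists>K. \<forall>z. (\<integral>\<omega>. (rep (W z) \<omega>)\<^sup>2 \<partial>M) \<le> K\<^sup>2 * (norm z)\<^sup>2"
    if W: "bounded_linear_into (L2_real M) W" for W
  proof -
    obtain K where K: "vnorm (L2_real M) (W z) \<le> K * norm z" for z
      using W by (auto simp: bounded_linear_into_def)
    have "(\<integral>\<omega>. (rep (W z) \<omega>)\<^sup>2 \<partial>M) \<le> K\<^sup>2 * (norm z)\<^sup>2" for z
      using power_mono[OF K[of z] vnorm_L2_nonneg(1), of 2]
      by (simp add: vnorm_L2_real_squared power_mult_distrib)
    then show ?thesis by blast
  qed
  then obtain K L where K: "(\<integral>\<omega>. (rep (T z) \<omega>)\<^sup>2 \<partial>M) \<le> K\<^sup>2 * (norm z)\<^sup>2"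
    and L: "(\<integral>\<omega>. (rep (U z) \<omega>)\<^sup>2 \<partial>M) \<le> L\<^sup>2 * (norm z)\<^sup>2" for z
    using T U by metis
  define d where "d \<omega> = rep (T x) \<omega> + (-1) *\<^sub>R rep (U x) \<omega>" for \<omega>
  have d: "d \<in> ?S"
    unfolding d_def by (intro real_square_integrable_add real_square_integrable_scaleR S T U)
  have bound: "(\<integral>\<omega>. (d \<omega>)\<^sup>2 \<partial>M) \<le> 2 * (K\<^sup>2 + L\<^sup>2) * (dist y x)\<^sup>2" if "y \<in> span E" for y
  proof -
    have split: "AE \<omega> in M. rep (W x) \<omega> = rep (W y) \<omega> + rep (W (x - y)) \<omega>"
      if W: "bounded_linear_into (L2_real M) W" for W
    proof -
      have "W x = vadd (L2_real M) (W y) (W (x - y))"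
        using W unfolding bounded_linear_into_def by (metis add.commute diff_add_cancel)
      also have "\<dots> = ae_class M ?S (\<lambda>\<omega>. rep (W y) \<omega> + rep (W (x - y)) \<omega>)"
        using vadd_real_class[OF S(1)[OF W] S(1)[OF W], of y "x - y"] by (simp add: S(2)[OF W])
      finally show ?thesis
        using S[OF W, of x] ae_class_eq_iff[OF S(1)[OF W] real_square_integrable_add[OF S(1)[OF W] S(1)[OF W]]]
        by metis
    qed
    have int: "integrable M (\<lambda>\<omega>. (rep (T (x - y)) \<omega>)\<^sup>2)" "integrable M (\<lambda>\<omega>. (rep (U (x - y)) \<omega>)\<^sup>2)"
      using S(1)[OF T] S(1)[OF U] by (auto simp: real_square_integrable_def)
    have "(\<integral>\<omega>. (d \<omega>)\<^sup>2 \<partial>M) \<le>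
        (\<integral>\<omega>. 2 * (rep (T (x - y)) \<omega>)\<^sup>2 + 2 * (rep (U (x - y)) \<omega>)\<^sup>2 \<partial>M)"
    proof (rule integral_mono_AE)
      show "AE \<omega> in M. (d \<omega>)\<^sup>2 \<le> 2 * (rep (T (x - y)) \<omega>)\<^sup>2 + 2 * (rep (U (x - y)) \<omega>)\<^sup>2"
        using split[OF T] split[OF U]
      proof eventually_elim
        case (elim \<omega>)
        have "d \<omega> = rep (T (x - y)) \<omega> + - rep (U (x - y)) \<omega>"
          using elim by (simp add: d_def span[OF \<open>y \<in> span E\<close>])
        then show ?case
          using square_sum_le[of "rep (T (x - y)) \<omega>" "- rep (U (x - y)) \<omega>"] by simp
      qed
    qed (use d int in \<open>auto simp: real_square_integrable_def\<close>)
    also have "\<dots> = 2 * (\<integral>\<omega>. (rep (T (x - y)) \<omega>)\<^sup>2 \<partial>M) + 2 * (\<integral>\<omega>. (rep (U (x - y)) \<omega>)\<^sup>2 \<partial>M)"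
      using int by simp
    also have "\<dots> \<le> 2 * (K\<^sup>2 + L\<^sup>2) * (dist y x)\<^sup>2"
      using K[of "x - y"] L[of "x - y"] by (simp add: dist_norm norm_minus_commute algebra_simps)
    finally show ?thesis .
  qed
  obtain y where y: "\<And>n. y n \<in> span E" "y \<longlonglongrightarrow> x"
    using dense closure_sequential[of x "span E"] by auto
  have "(\<lambda>n. 2 * (K\<^sup>2 + L\<^sup>2) * (dist (y n) x)\<^sup>2) \<longlonglongrightarrow> 2 * (K\<^sup>2 + L\<^sup>2) * 0\<^sup>2"
    using y(2) by (intro tendsto_intros) (simp add: tendsto_dist_iff[symmetric])
  then have "(\<integral>\<omega>. (d \<omega>)\<^sup>2 \<partial>M) \<le> 0"
    using LIMSEQ_le_const[of _ 0 "\<integral>\<omega>. (d \<omega>)\<^sup>2 \<partial>M"] bound[OF y(1)] by auto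
  moreover have "0 \<le> (\<integral>\<omega>. (d \<omega>)\<^sup>2 \<partial>M)" by simp
  ultimately have "AE \<omega> in M. d \<omega> = 0"
    using AE_eq_if_integral_square_zero[OF d] by simp
  then have "AE \<omega> in M. rep (T x) \<omega> = rep (U x) \<omega>"
    by (simp add: d_def)
  then show "T x = U x"
    using ae_class_eq_iff[OF S(1)[OF T, of x] S(1)[OF U, of x], of M] S(2)[OF T] S(2)[OF U] by simp
qed

section \<open>The operator of a square-integrable function\<close>

context complete_measure
begin

lemma vnorm_H_op_squared:
  assumes "V \<in> vcarrier (L2_bochner M)"
  shows "(vnorm (L2_real M) (H_op M V x))\<^sup>2 = (\<integral>\<omega>. (rep V \<omega> \<bullet> x)\<^sup>2 \<partial>M)"
  unfolding H_op_def
  by (intro vnorm_real_class_squared inner_square_integrable L2_bochner_rep assms)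

lemma H_op_ae_class:
  assumes "v \<in> bochner_square_integrable M"
  shows "H_op M (ae_class M (bochner_square_integrable M) v) x =
    ae_class M (real_square_integrable M) (\<lambda>\<omega>. v \<omega> \<bullet> x)"
proof -
  have "AE \<omega> in M. rep (ae_class M (bochner_square_integrable M) v) \<omega> \<bullet> x = v \<omega> \<bullet> x"
    using AE_rep_ae_class[OF assms] by eventually_elim simp
  then show ?thesis
    unfolding H_op_def
    by (subst ae_class_eq_iff)
      (auto intro!: inner_square_integrable assms rep_in[OF ae_class_in_quotient])
qed

lemma H_op_bounded_linear:
  assumes "V \<in> vcarrier (L2_bochner M)"
  shows "bounded_linear_into (L2_real M) (H_op M V)"
  unfolding bounded_linear_into_def
proof (intro conjI allI)
  have v: "rep V \<in> bochner_square_integrable M"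
    using assms by (rule L2_bochner_rep)
  note S = inner_square_integrable(1)[OF v]
  show "H_op M V x \<in> vcarrier (L2_real M)" for x
    by (simp add: H_op_def L2_real_class_in S)
  show "H_op M V (x + y) = vadd (L2_real M) (H_op M V x) (H_op M V y)" for x y
    by (simp add: H_op_def vadd_real_class[OF S S] inner_add_right)
  show "H_op M V (c *\<^sub>R x) = vscale (L2_real M) c (H_op M V x)" for c x
    by (simp add: H_op_def vscale_real_class[OF S])
  show "\<exists>K. \<forall>x. vnorm (L2_real M) (H_op M V x) \<le> K * norm x"
  proof (intro exI allI)
    show "vnorm (L2_real M) (H_op M V x) \<le> vnorm (L2_bochner M) V * norm x" for x
    proof (rule power2_le_imp_le)
      show "(vnorm (L2_real M) (H_op M V x))\<^sup>2 \<le> (vnorm (L2_bochner M) V * norm x)\<^sup>2"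
        using inner_square_integrable(2)[OF v, of x]
        by (simp add: vnorm_H_op_squared[OF assms] power_mult_distrib vnorm_L2_bochner_squared)
    qed (simp add: vnorm_L2_nonneg)
  qed
qed

lemma H_op_has_sum:
  fixes V :: "('a \<Rightarrow> 'h::real_inner) set"
  assumes "V \<in> vcarrier (L2_bochner M)" "orthonormal_basis E"
  shows "((\<lambda>e. (vnorm (L2_real M) (H_op M V e))\<^sup>2) has_sum (vnorm (L2_bochner M) V)\<^sup>2) E"
  unfolding vnorm_H_op_squared[OF assms(1)] vnorm_L2_bochner_squared
  by (rule integrated_Parseval[OF assms(2) L2_bochner_rep(1)[OF assms(1)]])

text \<open>
  The sum over an orthonormal basis is \<open>\<parallel>v\<parallel>\<^sup>2\<close> for every basis, and the existence of a basis makes the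
  defining description unique.
\<close>

lemma hs_norm_H_op:
  fixes V :: "('a \<Rightarrow> 'h::{real_inner,complete_space}) set"
  assumes "V \<in> vcarrier (L2_bochner M)"
  shows "hs_norm (L2_real M) (H_op M V) = vnorm (L2_bochner M) V"
proof -
  have *: "sqrt (\<Sum>\<^sub>\<infinity>e\<in>E. (vnorm (L2_real M) (H_op M V e))\<^sup>2) = vnorm (L2_bochner M) V"
    if "orthonormal_basis E" for E
    using infsumI[OF H_op_has_sum[OF assms that]] by (simp add: vnorm_L2_nonneg)
  show ?thesis
    unfolding hs_norm_def
    by (rule the_equality) (use * orthonormal_basis_exists in auto)
qed

lemma H_op_in_hs_operators:
  fixes V :: "('a \<Rightarrow> 'h::{real_inner,complete_space}) set"
  assumes "V \<in> vcarrier (L2_bochner M)"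
  shows "H_op M V \<in> hs_operators (L2_real M)"
  unfolding hs_operators_def
  using H_op_bounded_linear[OF assms] has_sum_imp_summable[OF H_op_has_sum[OF assms]] by blast

text \<open>
  If \<open>H\<^sub>u = H\<^sub>v\<close>, then all Fourier coefficients of \<open>u - v\<close> vanish almost everywhere, and
  \<open>integrated_Parseval\<close> gives \<open>\<parallel>u - v\<parallel> = 0\<close>. The exceptional null sets depend on the basis vector, so
  this cannot be concluded from a pointwise argument.
\<close>

lemma H_op_inj:
  "inj_on (H_op M) (vcarrier (L2_bochner M :: ('a \<Rightarrow> 'h::{real_inner,complete_space}) set normed_structure))"
proof
  let ?S = "bochner_square_integrable M :: ('a \<Rightarrow> 'h) set"
  fix U V :: "('a \<Rightarrow> 'h) set"
  assume "U \<in> vcarrier (L2_bochner M)" "V \<in> vcarrier (L2_bochner M)" and eq: "H_op M U = H_op M V"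
  then have U: "rep U \<in> ?S" "ae_class M ?S (rep U) = U" and V: "rep V \<in> ?S" "ae_class M ?S (rep V) = V"
    by (simp_all add: L2_bochner_rep)
  define w where "w \<omega> = rep U \<omega> + (-1) *\<^sub>R rep V \<omega>" for \<omega>
  have w: "w \<in> ?S"
    unfolding w_def by (intro bochner_square_integrable_add bochner_square_integrable_scaleR U V)
  have "(\<integral>\<omega>. (w \<omega> \<bullet> x)\<^sup>2 \<partial>M) = 0" for x
  proof (rule integral_eq_zero_AE)
    have "AE \<omega> in M. rep U \<omega> \<bullet> x = rep V \<omega> \<bullet> x"
      using fun_cong[OF eq, of x] ae_class_eq_iff[OF inner_square_integrable(1)[OF U(1)] inner_square_integrable(1)[OF V(1)]]
      unfolding H_op_def by blast
    then show "AE \<omega> in M. (w \<omega> \<bullet> x)\<^sup>2 = 0"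
      by eventually_elim (simp add: w_def inner_diff_left)
  qed
  moreover obtain E :: "'h set" where "orthonormal_basis E"
    using orthonormal_basis_exists by blast
  ultimately have "((\<lambda>e. 0) has_sum (\<integral>\<omega>. (norm (w \<omega>))\<^sup>2 \<partial>M)) E"
    using integrated_Parseval[OF _ w] by simp
  from infsumI[OF this] have "(\<integral>\<omega>. (norm (w \<omega>))\<^sup>2 \<partial>M) = 0"
    by simp
  then have "AE \<omega> in M. w \<omega> = 0"
    using w integral_nonneg_eq_0_iff_AE[of M "\<lambda>\<omega>. (norm (w \<omega>))\<^sup>2"]
    by (simp add: bochner_square_integrable_def)
  then have "AE \<omega> in M. rep U \<omega> = rep V \<omega>" by (simp add: w_def)
  then show "U = V" using ae_class_eq_iff[OF U(1) V(1)] U(2) V(2) by metis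
qed

section \<open>The function of a Hilbert--Schmidt operator\<close>

text \<open>
  Approximate each coefficient by simple functions and cut the series off at \<open>N\<close>. The error has squared
  norm at most the sum of the squared errors of the coefficients. Each of these tends to zero as \<open>N\<close>
  grows, and they are dominated by a summable sequence, so Tannery's theorem applies.
\<close>

lemma bochner_measurable_orthogonal_series:
  fixes b :: "nat \<Rightarrow> 'h::{real_inner,complete_space}"
  assumes orth: "\<And>m n. m \<noteq> n \<Longrightarrow> b m \<bullet> b n = 0" and norm_le: "\<And>n. norm (b n) \<le> 1"
    and f: "\<And>n. f n \<in> borel_measurable M"
    and sm: "AE \<omega> in M. summable (\<lambda>n. (f n \<omega>)\<^sup>2)"
  shows "bochner_measurable M (\<lambda>\<omega>. \<Sum>n. f n \<omega> *\<^sub>R b n)"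
proof -
  have "\<forall>n. \<exists>F. (\<forall>i. simple_function M (F i)) \<and> (\<forall>x\<in>space M. (\<lambda>i. F i x) \<longlonglongrightarrow> f n x) \<and>
    (\<forall>i. \<forall>x\<in>space M. dist (F i x) 0 \<le> 2 * dist (f n x) 0)"
    using borel_measurable_implies_sequence_metric[OF f] by blast
  then obtain F where F: "\<And>n i. simple_function M (F n i)"
    "\<And>n x. x \<in> space M \<Longrightarrow> (\<lambda>i. F n i x) \<longlonglongrightarrow> f n x"
    "\<And>n i x. x \<in> space M \<Longrightarrow> \<bar>F n i x\<bar> \<le> 2 * \<bar>f n x\<bar>"
    by (simp add: choice_iff) metis
  define s where "s N \<omega> = (\<Sum>n<N. F n N \<omega> *\<^sub>R b n)" for N \<omega>
  have "simple_function M (s N)" for N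
    unfolding s_def
  proof (rule simple_function_sum)
    show "simple_function M (\<lambda>\<omega>. F n N \<omega> *\<^sub>R b n)" for n
      using simple_function_compose1[OF F(1), of "\<lambda>r. r *\<^sub>R b n"] .
  qed
  moreover have "AE \<omega> in M. (\<lambda>N. s N \<omega>) \<longlonglongrightarrow> (\<Sum>n. f n \<omega> *\<^sub>R b n)"
    using sm AE_space
  proof eventually_elim
    case (elim \<omega>)
    \<comment> \<open>The error of the \<open>n\<close>-th coefficient at stage \<open>N\<close>; for \<open>n \<ge> N\<close> the term is cut off and the error is the whole coefficient.\<close>
    define a where "a n N = (if n < N then F n N \<omega> else 0) - f n \<omega>" for n N
    have a_lim: "(\<lambda>N. (a n N)\<^sup>2) \<longlonglongrightarrow> 0" for n
    proof -
      have "\<forall>\<^sub>F N in sequentially. F n N \<omega> - f n \<omega> = a n N"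
        using eventually_gt_at_top[of n] by eventually_elim (simp add: a_def)
      moreover have "(\<lambda>N. F n N \<omega> - f n \<omega>) \<longlonglongrightarrow> 0"
        using F(2)[OF elim(2), of n] by (simp add: LIM_zero_iff)
      ultimately have "(\<lambda>N. a n N) \<longlonglongrightarrow> 0"
        by (rule Lim_transform_eventually[rotated])
      then show ?thesis using tendsto_power[of _ 0 _ 2] by fastforce
    qed
    \<comment> \<open>The factor 3 comes from the approximants being bounded by twice the coefficient.\<close>
    have "\<bar>a n N\<bar> \<le> 3 * \<bar>f n \<omega>\<bar>" for n N
      using F(3)[OF elim(2), of n N] by (auto simp: a_def)
    then have a_le: "(a n N)\<^sup>2 \<le> 9 * (f n \<omega>)\<^sup>2" for n N
      using power_mono[of "\<bar>a n N\<bar>" "3 * \<bar>f n \<omega>\<bar>" 2] by (simp add: power_mult_distrib)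
    have dom: "summable (\<lambda>n. 9 * (f n \<omega>)\<^sup>2)" using elim(1) by (rule summable_mult)
    have a_sm: "summable (\<lambda>n. (a n N)\<^sup>2)" for N
      by (rule summable_comparison_test'[OF dom, of 0]) (use a_le in auto)
    have "(\<lambda>N. \<Sum>n. (a n N)\<^sup>2) \<longlonglongrightarrow> (\<Sum>n. 0)"
      using tannerys_theorem[of "\<lambda>n N. (a n N)\<^sup>2" "\<lambda>_. 0" sequentially "\<lambda>n. 9 * (f n \<omega>)\<^sup>2"]
        a_lim a_le dom by (simp add: eventually_prod_sequentially)
    then have lim: "(\<lambda>N. \<Sum>n. (a n N)\<^sup>2) \<longlonglongrightarrow> 0" by simp
    have "(norm (s N \<omega> - (\<Sum>n. f n \<omega> *\<^sub>R b n)))\<^sup>2 \<le> (\<Sum>n. (a n N)\<^sup>2)" for N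
    proof -
      have "(\<lambda>n. (if n < N then F n N \<omega> else 0) *\<^sub>R b n) sums s N \<omega>"
        using sums_If_finite_set[of "{..<N}" "\<lambda>n. F n N \<omega> *\<^sub>R b n"]
        by (simp add: s_def if_distrib[of "\<lambda>r. r *\<^sub>R _"] cong: if_cong)
      moreover have "(\<lambda>n. f n \<omega> *\<^sub>R b n) sums (\<Sum>n. f n \<omega> *\<^sub>R b n)"
        using summable_orthogonal_series[where b = b, OF orth norm_le elim(1)] by (rule summable_sums)
      ultimately have "(\<lambda>n. a n N *\<^sub>R b n) sums (s N \<omega> - (\<Sum>n. f n \<omega> *\<^sub>R b n))"
        unfolding a_def scaleR_diff_left by (rule sums_diff)
      then have sums: "(\<lambda>n. (a n N)\<^sup>2 * (norm (b n))\<^sup>2) sums (norm (s N \<omega> - (\<Sum>n. f n \<omega> *\<^sub>R b n)))\<^sup>2"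
        using norm_orthogonal_series[where b = b, OF orth norm_le a_sm[of N]] by (simp add: sums_iff)
      show ?thesis
        by (rule sums_le[OF _ sums summable_sums[OF a_sm[of N]]])
          (auto intro!: mult_left_le simp: norm_le abs_square_le_1)
    qed
    then have "(\<lambda>N. (norm (s N \<omega> - (\<Sum>n. f n \<omega> *\<^sub>R b n)))\<^sup>2) \<longlonglongrightarrow> 0"
      by (intro tendsto_sandwich[OF _ _ tendsto_const lim]) auto
    then have "(\<lambda>N. norm (s N \<omega> - (\<Sum>n. f n \<omega> *\<^sub>R b n))) \<longlonglongrightarrow> 0"
      using tendsto_real_sqrt[of _ 0] by fastforce
    then show ?case by (simp add: tendsto_norm_zero_iff LIM_zero_iff)
  qed
  ultimately show ?thesis unfolding bochner_measurable_iff by blast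
qed

text \<open>
  By monotone convergence \<open>\<Sum>n. (f n \<omega>)\<^sup>2\<close> has finite integral, so it is finite almost everywhere and
  the series converges there.
\<close>

lemma orthogonal_series_square_integrable:
  fixes b :: "nat \<Rightarrow> 'h::{real_inner,complete_space}"
  assumes orth: "\<And>m n. m \<noteq> n \<Longrightarrow> b m \<bullet> b n = 0" and norm_le: "\<And>n. norm (b n) \<le> 1"
    and f: "\<And>n. f n \<in> real_square_integrable M"
    and sm: "summable (\<lambda>n. \<integral>\<omega>. (f n \<omega>)\<^sup>2 \<partial>M)"
  shows "(\<lambda>\<omega>. \<Sum>n. f n \<omega> *\<^sub>R b n) \<in> bochner_square_integrable M"
    and "AE \<omega> in M. (\<lambda>n. f n \<omega> *\<^sub>R b n) sums (\<Sum>n. f n \<omega> *\<^sub>R b n)"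
proof -
  let ?v = "\<lambda>\<omega>. \<Sum>n. f n \<omega> *\<^sub>R b n"
  have fm [measurable]: "f n \<in> borel_measurable M" and fi: "integrable M (\<lambda>\<omega>. (f n \<omega>)\<^sup>2)" for n
    using f by (auto simp: real_square_integrable_def)
  have "(\<integral>\<^sup>+\<omega>. (\<Sum>n. ennreal ((f n \<omega>)\<^sup>2)) \<partial>M) = (\<Sum>n. \<integral>\<^sup>+\<omega>. ennreal ((f n \<omega>)\<^sup>2) \<partial>M)"
    by (intro nn_integral_suminf) auto
  also have "\<dots> = (\<Sum>n. ennreal (\<integral>\<omega>. (f n \<omega>)\<^sup>2 \<partial>M))"
    using fi by (simp add: nn_integral_eq_integral)
  also have "\<dots> \<noteq> \<infinity>"
    unfolding infinity_ennreal_def by (rule ennreal_suminf_neq_top[OF sm]) simp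
  finally have "AE \<omega> in M. (\<Sum>n. ennreal ((f n \<omega>)\<^sup>2)) \<noteq> \<infinity>"
    by (intro nn_integral_PInf_AE) auto
  then have AE_sm: "AE \<omega> in M. summable (\<lambda>n. (f n \<omega>)\<^sup>2)"
    by eventually_elim (rule summable_suminf_not_top, auto)
  then show "AE \<omega> in M. (\<lambda>n. f n \<omega> *\<^sub>R b n) sums ?v \<omega>"
    by eventually_elim
      (rule summable_sums, rule summable_orthogonal_series[where b = b, OF orth norm_le])
  have bm: "bochner_measurable M ?v"
    by (rule bochner_measurable_orthogonal_series[OF orth norm_le fm AE_sm])
  have "integrable M (\<lambda>\<omega>. (norm (?v \<omega>))\<^sup>2)"
  proof (rule Bochner_Integration.integrable_bound)
    show "integrable M (\<lambda>\<omega>. \<Sum>n. (f n \<omega>)\<^sup>2)"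
      using fi AE_sm sm by (intro integrable_suminf) auto
    show "(\<lambda>\<omega>. (norm (?v \<omega>))\<^sup>2) \<in> borel_measurable M"
      by (rule borel_measurable_bochner_compose[OF bm]) (intro continuous_intros)
    show "AE \<omega> in M. norm ((norm (?v \<omega>))\<^sup>2) \<le> norm (\<Sum>n. (f n \<omega>)\<^sup>2)"
      using AE_sm
    proof eventually_elim
      case (elim \<omega>)
      have "(norm (?v \<omega>))\<^sup>2 \<le> (\<Sum>n. (f n \<omega>)\<^sup>2)"
        by (rule sums_le[OF _ norm_orthogonal_series[where b = b, OF orth norm_le elim] summable_sums[OF elim]])
          (auto intro!: mult_left_le simp: norm_le abs_square_le_1)
      then show ?case by simp
    qed
  qed
  with bm show "?v \<in> bochner_square_integrable M"
    by (simp add: bochner_square_integrable_def)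
qed

text \<open>
  The preimage is \<open>v(\<omega>) = \<Sum>n. (T b\<^sub>n)(\<omega>) b\<^sub>n\<close>, where \<open>b\<close> runs through the basis vectors that \<open>T\<close> does
  not annihilate, padded with zeros. Basis vectors outside this list are mapped to zero by \<open>T\<close> and, by orthogonality, by
  \<open>H\<^sub>v\<close>.
\<close>

lemma H_op_surj:
  fixes T :: "'h::{real_inner,complete_space} \<Rightarrow> ('a \<Rightarrow> real) set"
  assumes T: "T \<in> hs_operators (L2_real M)"
  shows "\<exists>V \<in> vcarrier (L2_bochner M). H_op M V = T"
proof -
  let ?S = "real_square_integrable M"
  obtain E :: "'h set" where E: "orthonormal_basis E"
    using orthonormal_basis_exists by blast
  have on: "orthonormal E" and dense: "closure (span E) = UNIV"
    using E by (auto simp: orthonormal_basis_iff)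
  have bl: "bounded_linear_into (L2_real M) T"
    using T by (simp add: hs_operators_def)
  have TS: "rep (T x) \<in> ?S" "ae_class M ?S (rep (T x)) = T x" for x
    using bl L2_real_rep[of "T x" M] by (simp_all add: bounded_linear_into_def)
  define q where "q x = (\<integral>\<omega>. (rep (T x) \<omega>)\<^sup>2 \<partial>M)" for x
  have q: "q summable_on E"
    using T E by (simp add: hs_operators_def q_def[abs_def] vnorm_L2_real_squared)
  have q0: "q 0 = 0"
    using bl vnorm_L2_nonneg(1)[of M "T 0"] vnorm_L2_real_squared[of M "T 0"]
    unfolding bounded_linear_into_def q_def
    by (metis mult_zero_right norm_zero antisym zero_power2)
  \<comment> \<open>The norm of \<open>T e\<close> is square-summable over \<open>E\<close>, so all but countably many \<open>T e\<close> vanish.\<close>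
  define C where "C = {e\<in>E. q e \<noteq> 0}"
  have onC: "orthonormal C" using on by (auto simp: C_def orthonormal_def pairwise_def)
  have "countable C" using summable_countable_real[OF q] by (simp add: C_def)
  obtain b :: "nat \<Rightarrow> 'h" where b: "\<And>n. b n \<in> insert 0 C" "C \<subseteq> range b"
    and orth: "\<And>m n. m \<noteq> n \<Longrightarrow> b m \<bullet> b n = 0" and norm_le: "\<And>n. norm (b n) \<le> 1"
    and reindex: "\<And>(g :: 'h \<Rightarrow> real) s. g 0 = 0 \<Longrightarrow> (g has_sum s) C \<longleftrightarrow> ((\<lambda>n. g (b n)) has_sum s) UNIV"
    by (rule orthonormal_enumerate[OF onC \<open>countable C\<close>]) blast
  have "q summable_on C"
    using q by (rule summable_on_subset_banach) (auto simp: C_def)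
  then obtain s where "(q has_sum s) C" by (auto simp: summable_on_def)
  then have sm: "summable (\<lambda>n. q (b n))"
    using reindex[of q s] q0 by (auto dest: has_sum_imp_sums sums_summable)
  define f where "f n = rep (T (b n))" for n
  define v where "v \<omega> = (\<Sum>n. f n \<omega> *\<^sub>R b n)" for \<omega>
  have v: "v \<in> bochner_square_integrable M"
    and v_sums: "AE \<omega> in M. (\<lambda>n. f n \<omega> *\<^sub>R b n) sums v \<omega>"
    unfolding v_def
    by (rule orthogonal_series_square_integrable[OF orth norm_le]; use TS sm in \<open>simp add: f_def q_def\<close>)+
  have v_inner: "AE \<omega> in M. (\<lambda>n. f n \<omega> * (b n \<bullet> x)) sums (v \<omega> \<bullet> x)" for x
    using v_sums
    by eventually_elim (use bounded_linear.sums[OF bounded_linear_inner_left] in fastforce)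
  define V where "V = ae_class M (bochner_square_integrable M) v"
  have V: "V \<in> vcarrier (L2_bochner M)"
    using v by (simp add: V_def L2_bochner_class_in)
  have "H_op M V e = T e" if e: "e \<in> E" for e
  proof -
    have "AE \<omega> in M. v \<omega> \<bullet> e = rep (T e) \<omega>"
    proof (cases "e \<in> C")
      case True
      then obtain m where m: "b m = e" using b(2) by auto
      have "e \<bullet> e = 1" using orthonormal_inner[OF on e e] by simp
      then have "(\<lambda>n. f n \<omega> * (b n \<bullet> e)) = (\<lambda>n. if n = m then rep (T e) \<omega> else 0)" for \<omega>
        using orth[of _ m] by (auto simp: fun_eq_iff m f_def)
      then have "(\<lambda>n. f n \<omega> * (b n \<bullet> e)) sums rep (T e) \<omega>" for \<omega>
        using sums_single[of m "\<lambda>_. rep (T e) \<omega>"] by simp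
      then show ?thesis using v_inner[of e] by (auto elim!: eventually_mono intro: sums_unique2)
    next
      case False
      have b_e: "b n \<bullet> e = 0" for n
        using b(1)[of n] False e orthonormal_inner[OF on, of "b n" e] by (auto simp: C_def)
      have "AE \<omega> in M. v \<omega> \<bullet> e = 0"
        using v_inner[of e] by eventually_elim (simp add: b_e sums_iff)
      moreover have "AE \<omega> in M. rep (T e) \<omega> = 0"
        using False e by (intro AE_eq_if_integral_square_zero TS) (simp add: C_def q_def)
      ultimately show ?thesis by eventually_elim simp
    qed
    then have "ae_class M ?S (\<lambda>\<omega>. v \<omega> \<bullet> e) = ae_class M ?S (rep (T e))"
      by (subst ae_class_eq_iff) (auto intro: inner_square_integrable v TS)
    then show ?thesis
      unfolding V_def H_op_ae_class[OF v] by (simp add: TS)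
  qed
  then have "H_op M V = T"
    by (rule bounded_linear_into_L2_eqI[OF H_op_bounded_linear[OF V] bl _ dense])
  with V show ?thesis by blast
qed

end

section \<open>The isometric isomorphism\<close>

theorem corollary2p3:
  fixes M :: "'a measure"
  assumes "complete_measure M"
  shows "isometric_isomorphism
    (L2_bochner M :: ('a \<Rightarrow> 'h::{real_inner,complete_space}) set normed_structure)
    (HS (L2_real M))
    (H_op M)"
proof -
  interpret complete_measure M by fact
  let ?L = "L2_bochner M :: ('a \<Rightarrow> 'h) set normed_structure"
  let ?B = "bochner_square_integrable M :: ('a \<Rightarrow> 'h) set"
  have rep: "rep U \<in> ?B" "ae_class M ?B (rep U) = U" if "U \<in> vcarrier ?L" for U
    using L2_bochner_rep[OF that] .
  have "bij_betw (H_op M) (vcarrier ?L) (vcarrier (HS (L2_real M)))"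
  proof (rule bij_betw_imageI[OF H_op_inj])
    show "H_op M ` vcarrier ?L = vcarrier (HS (L2_real M))"
    proof
      show "H_op M ` vcarrier ?L \<subseteq> vcarrier (HS (L2_real M))"
        using H_op_in_hs_operators by (auto simp: HS_def)
      show "vcarrier (HS (L2_real M)) \<subseteq> H_op M ` vcarrier ?L"
      proof
        fix T :: "'h \<Rightarrow> ('a \<Rightarrow> real) set" assume "T \<in> vcarrier (HS (L2_real M))"
        then have "T \<in> hs_operators (L2_real M)" by (simp add: HS_def)
        from H_op_surj[OF this] show "T \<in> H_op M ` vcarrier ?L" by force
      qed
    qed
  qed
  moreover have "H_op M (vadd ?L U V) = vadd (HS (L2_real M)) (H_op M U) (H_op M V)"
    if U: "U \<in> vcarrier ?L" and V: "V \<in> vcarrier ?L" for U V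
  proof
    fix x
    note u = rep(1)[OF U] and v = rep(1)[OF V]
    have "vadd ?L U V = ae_class M ?B (\<lambda>\<omega>. rep U \<omega> + rep V \<omega>)"
      using vadd_bochner_class[OF u v]
      by (simp only: rep(2)[OF U] rep(2)[OF V])
    then have "H_op M (vadd ?L U V) x =
        ae_class M (real_square_integrable M) (\<lambda>\<omega>. rep U \<omega> \<bullet> x + rep V \<omega> \<bullet> x)"
      by (simp add: H_op_ae_class bochner_square_integrable_add u v inner_add_left)
    also have "\<dots> = vadd (L2_real M) (H_op M U x) (H_op M V x)"
      by (simp add: H_op_def vadd_real_class inner_square_integrable u v)
    finally show "H_op M (vadd ?L U V) x = vadd (HS (L2_real M)) (H_op M U) (H_op M V) x"
      by (simp add: HS_def)
  qed
  moreover have "H_op M (vscale ?L c U) = vscale (HS (L2_real M)) c (H_op M U)"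
    if U: "U \<in> vcarrier ?L" for c U
  proof
    fix x
    note u = rep(1)[OF U]
    have "vscale ?L c U = ae_class M ?B (\<lambda>\<omega>. c *\<^sub>R rep U \<omega>)"
      using vscale_bochner_class[OF u]
      by (simp only: rep(2)[OF U])
    then have "H_op M (vscale ?L c U) x =
        ae_class M (real_square_integrable M) (\<lambda>\<omega>. c *\<^sub>R (rep U \<omega> \<bullet> x))"
      by (simp add: H_op_ae_class bochner_square_integrable_scaleR u)
    also have "\<dots> = vscale (L2_real M) c (H_op M U x)"
      unfolding H_op_def by (rule vscale_real_class[symmetric]) (rule inner_square_integrable[OF u])
    finally show "H_op M (vscale ?L c U) x = vscale (HS (L2_real M)) c (H_op M U) x"
      by (simp add: HS_def)
  qed
  moreover have "vnorm (HS (L2_real M)) (H_op M U) = vnorm ?L U" if "U \<in> vcarrier ?L" for U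
    using hs_norm_H_op[OF that] by (simp add: HS_def)
  ultimately show ?thesis unfolding isometric_isomorphism_def by blast
qed

end
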